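(* Let $(V,\sigma)$ be a finite-dimensional braided vector space over $\mathbb{C}$ with quantum exterior algebra $\bigwedge_\sigma V=\bigoplus_{k\ge 0}\bigwedge_\sigma^k V$, and let $\mathfrak{A}$ be an associative algebra. For each $k\geq 1$ let $d_k=\dim\bigwedge_\sigma^kV$ and let $\{\omega_{k,1},\ldots,\omega_{k,d_k}\}$ be a basis of $\bigwedge_\sigma^k V$. Let $m,n\geq 1$ and $p=m+n$, and let the scalars $\mu(m,n)_{i,j}^k,\lambda(p)_k^{i,j}\in\mathbb{C}$ be defined by $$\omega_{m,i}\odot_\sigma \omega_{n,j}=\sum_{k=1}^{d_p}\mu(m,n)_{i,j}^k\,\omega_{p,k},\qquad \Delta_{m,n}(\omega_{p,k})=\sum_{i=1}^{d_m}\sum_{j=1}^{d_n}\lambda(p)_k^{i,j}\,\omega_{m,i}\otimes \omega_{n,j}.$$ Then for any linear map $F:V\to V\otimes\mathfrak{A}$ and all $1\le i,j\le d_p$, the quantum minor determinants of $F$ satisfy $$\xi(F,m+n)^i_j=\sum_{k,r=1}^{d_m}\sum_{l,s=1}^{d_n}\lambda(m+n)_j^{k,l}\,\mu(m,n)_{r,s}^i\, \xi(F,m)_k^r\, \xi(F,n)_l^s .$$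
   Context: Everything is over $\mathbb{C}$. Let $(n)_\nu=\frac{1-\nu^n}{1-\nu}$, $(n)_\nu!=(1)_\nu\cdots(n)_\nu$, $(0)_\nu!=1$. Fix $q\in\mathbb{C}$ nonzero with $q^{-2}$ not a root of unity (so $(n)_{q^{-2}}\ne 0$ for all $n\ge1$, and $q^2\neq -1$). $V$ is a vector space of finite dimension $N$. A braiding on $V$ is an invertible $\sigma\in\mathrm{End}(V\otimes V)$ with $(\sigma\otimes I)(I\otimes\sigma)(\sigma\otimes I)=(I\otimes\sigma)(\sigma\otimes I)(I\otimes\sigma)$, where $I=\mathrm{id}_V$; $(V,\sigma)$ is called a braided (vector) space. On $V^{\otimes n}$ put $\sigma_i=\mathrm{id}_{V^{\otimes (i-1)}}\otimes\sigma\otimes \mathrm{id}_{V^{\otimes (n-i-1)}}$; for $w\in\mathfrak{S}_n$ with reduced expression $w=s_{i_1}\cdots s_{i_l}$ ($s_i$ the transposition of $i,i+1$; permutations compose as functions) put $\sigma_w=\sigma_{i_1}\cdots\sigma_{i_l}$ (independent of the reduced expression). $l(w)$ is the length of $w$. $\mathfrak{S}_{m,n}$ is the set of $(m,n)$-shuffles: $w\in\mathfrak{S}_{m+n}$ with $w(1)<\cdots<w(m)$ and $w(m+1)<\cdots<w(m+n)$. Define, on $V^{\otimes(m+n)}$, $$\mathrm{Sh}^{\pm}_{m,n}=\frac{(m)_{q^{-2}}!\,(n)_{q^{-2}}!}{(m+n)_{q^{-2}}!}\sum_{w\in\mathfrak{S}_{m,n}}(-q)^{-l(w)}\sigma_{w^{\pm1}}.$$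 The quantum shuffle product on $T(V)$ is $x\odot_\sigma y=\mathrm{Sh}^+_{m,n}(x\otimes y)$ for $x\in V^{\otimes m}$, $y\in V^{\otimes n}$ (scalar multiplication if $m$ or $n$ is $0$); it is associative and unital. The quantum exterior algebra $\bigwedge_\sigma V$ is the graded subalgebra of $(T(V),\odot_\sigma)$ generated by $V$. With $A^{(1)}=I$ and $A^{(k)}=\frac{1}{(k)_{q^{-2}}!}\sum_{w\in\mathfrak{S}_k}(-q)^{-l(w)}\sigma_w$, one has $\bigwedge_\sigma^kV=\mathrm{Im}A^{(k)}\subset V^{\otimes k}$ for $k\ge1$, $\bigwedge_\sigma^0V=\mathbb{C}$, and $A^{(m)}(x)\odot_\sigma A^{(n)}(y)=A^{(m+n)}(x\otimes y)$. For $m,n\ge1$, $\Delta_{m,n}:\bigwedge_\sigma^{m+n}V\to\bigwedge_\sigma^mV\otimes\bigwedge_\sigma^nV$ is the (well-defined) map determined by $\Delta_{m,n}A^{(m+n)}=(A^{(m)}\otimes A^{(n)})\mathrm{Sh}^-_{m,n}$. Let $\mathfrak{m}$ be the multiplication of $\mathfrak{A}$. The product $\cdot$ on $\bigwedge_\sigma V\otimes\mathfrak{A}$ is $(\alpha\otimes a)\cdot(\beta\otimes b)=(\alpha\odot_\sigma\beta)\otimes ab$. Put $\mathcal{E}^k(\mathfrak{A})=\mathrm{Hom}_{\mathbb{C}}(\bigwedge_\sigma^kV,\bigwedge_\sigma^kV\otimes\mathfrak{A})$. For $F\in\mathcal{E}^m(\mathfrak{A})$, $G\in\mathcal{E}^n(\mathfrak{A})$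 the convolution product is $F\ast G=\cdot\,(F\otimes G)\Delta_{m,n}\in\mathcal{E}^{m+n}(\mathfrak{A})$; it is associative, and $F^{\ast k}$ denotes the $k$-fold convolution power. For $F\in\mathcal{E}^1(\mathfrak{A})$ and $k\ge1$, the quantum $k$-minor determinants $\xi(F,k)_i^j\in\mathfrak{A}$ are the unique elements with $F^{\ast k}(\omega_{k,i})=\sum_{j=1}^{d_k}\omega_{k,j}\otimes\xi(F,k)_i^j$. *)

theory Defs
  imports Complex_Main "HOL-Library.Function_Algebras" "HOL-Combinatorics.Permutations"
begin

text \<open>
  Let \<open>V\<close> be a finite-dimensional space with a basis \<open>B\<close>. The words of length \<open>n\<close> in \<open>B\<close> index the
  basis \<open>b\<^sub>1 \<otimes> \<dots> \<otimes> b\<^sub>n\<close> of the \<open>n\<close>-th tensor power, so a tensor is represented by its coefficient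
  function on words, and \<open>T(V)\<close> is the space of finitely supported coefficient functions.
  With coefficients in a complex algebra \<open>A\<close> the same functions represent the \<open>n\<close>-th tensor power
  of \<open>V\<close> tensored with \<open>A\<close>.
\<close>

type_synonym ('v, 'm) tensor = "'v list \<Rightarrow> 'm"

definition words :: "'v set \<Rightarrow> nat \<Rightarrow> 'v list set" where
  "words B n = {w. set w \<subseteq> B \<and> length w = n}"

definition tensors :: "'v set \<Rightarrow> nat \<Rightarrow> ('v, 'm::zero) tensor set" where
  "tensors B n = {t. \<forall>w. w \<notin> words B n \<longrightarrow> t w = 0}"

definition tscale :: "complex \<Rightarrow> ('v, complex) tensor \<Rightarrow> ('v, complex) tensor" (infixr "\<cdot>\<^sub>T" 75) where
  "c \<cdot>\<^sub>T t = (\<lambda>w. c * t w)"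

global_interpretation tensor: vector_space tscale
  by unfold_locales (auto simp: tscale_def algebra_simps fun_eq_iff)

definition unit_tensor :: "'v list \<Rightarrow> ('v, complex) tensor" where
  "unit_tensor u = (\<lambda>w. if w = u then 1 else 0)"

text \<open>
  The multiplication of \<open>T(V)\<close> by concatenation of words. For \<open>x\<close> and \<open>y\<close> homogeneous of degrees
  \<open>m\<close> and \<open>n\<close> it is the tensor \<open>x \<otimes> y\<close>, the tensor product of the powers \<open>m\<close> and \<open>n\<close> being
  identified with the power \<open>m + n\<close>.
\<close>

definition tprod :: "('v, complex) tensor \<Rightarrow> ('v, complex) tensor \<Rightarrow> ('v, complex) tensor"
    (infixl "\<otimes>\<^sub>T" 70) where
  "x \<otimes>\<^sub>T y = (\<lambda>w. \<Sum>i\<le>length w. x (take i w) * y (drop i w))"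

definition component :: "nat \<Rightarrow> ('v, complex) tensor \<Rightarrow> ('v, complex) tensor" where
  "component n t = (\<lambda>w. if length w = n then t w else 0)"

text \<open>
  The linear map on the span of the \<open>x \<otimes> y\<close> with \<open>x\<close> in the subspace \<open>S\<close> and \<open>y\<close> in the
  subspace \<open>S'\<close> of two fixed tensor powers that is induced by a bilinear map \<open>\<beta>\<close> on \<open>S \<times> S'\<close>;
  for such \<open>\<beta>\<close> the value does not depend on the chosen decomposition.
\<close>

definition tensor_lift ::
  "('v, complex) tensor set \<Rightarrow> ('v, complex) tensor set \<Rightarrow>
   (('v, complex) tensor \<Rightarrow> ('v, complex) tensor \<Rightarrow> 'c::monoid_add) \<Rightarrow> ('v, complex) tensor \<Rightarrow> 'c" where
  "tensor_lift S S' \<beta> t =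
     (let zs = (SOME zs. set zs \<subseteq> S \<times> S' \<and> t = (\<Sum>(x, y)\<leftarrow>zs. x \<otimes>\<^sub>T y))
      in \<Sum>(x, y)\<leftarrow>zs. \<beta> x y)"

text \<open>
  \<open>braid_at \<sigma> i\<close> is \<open>\<sigma>\<^sub>i\<close>, i.e. \<open>\<sigma>\<close> acting on the tensor factors \<open>i\<close> and \<open>i + 1\<close>, where \<open>i \<ge> 1\<close>:
  its coefficient at a word is obtained by freezing all other letters, applying \<open>\<sigma>\<close> to the
  resulting element of the tensor square, and reading off the coefficient at the two letters.
\<close>

definition braid_at ::
  "(('v, complex) tensor \<Rightarrow> ('v, complex) tensor) \<Rightarrow> nat \<Rightarrow> ('v, complex) tensor \<Rightarrow> ('v, complex) tensor" where
  "braid_at \<sigma> i t = (\<lambda>w.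
     \<sigma> (\<lambda>u. if length u = 2 then t (take (i - 1) w @ u @ drop (i + 1) w) else 0)
       (take 2 (drop (i - 1) w)))"

definition braiding :: "'v set \<Rightarrow> (('v, complex) tensor \<Rightarrow> ('v, complex) tensor) \<Rightarrow> bool" where
  "braiding B \<sigma> \<longleftrightarrow>
     (\<forall>x\<in>tensors B 2. \<forall>y\<in>tensors B 2. \<sigma> (x + y) = \<sigma> x + \<sigma> y) \<and>
     (\<forall>c. \<forall>x\<in>tensors B 2. \<sigma> (c \<cdot>\<^sub>T x) = c \<cdot>\<^sub>T \<sigma> x) \<and>
     bij_betw \<sigma> (tensors B 2) (tensors B 2) \<and>
     (\<forall>t\<in>tensors B 3.
        braid_at \<sigma> 1 (braid_at \<sigma> 2 (braid_at \<sigma> 1 t)) = braid_at \<sigma> 2 (braid_at \<sigma> 1 (braid_at \<sigma> 2 t)))"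

definition expression :: "nat \<Rightarrow> (nat \<Rightarrow> nat) \<Rightarrow> nat list \<Rightarrow> bool" where
  "expression n w is \<longleftrightarrow> set is \<subseteq> {1..<n} \<and> w = foldr (\<lambda>i f. transpose i (i + 1) \<circ> f) is id"

definition perm_length :: "nat \<Rightarrow> (nat \<Rightarrow> nat) \<Rightarrow> nat" where
  "perm_length n w = (LEAST l. \<exists>is. expression n w is \<and> length is = l)"

definition reduced_expression :: "nat \<Rightarrow> (nat \<Rightarrow> nat) \<Rightarrow> nat list \<Rightarrow> bool" where
  "reduced_expression n w is \<longleftrightarrow> expression n w is \<and> length is = perm_length n w"

text \<open>For a braiding the value does not depend on the chosen reduced expression.\<close>

definition braid_perm ::
  "(('v, complex) tensor \<Rightarrow> ('v, complex) tensor) \<Rightarrow> nat \<Rightarrow> (nat \<Rightarrow> nat) \<Rightarrow>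
   ('v, complex) tensor \<Rightarrow> ('v, complex) tensor" where
  "braid_perm \<sigma> n w = foldr (\<lambda>i f. braid_at \<sigma> i \<circ> f) (SOME is. reduced_expression n w is) id"

definition qint :: "complex \<Rightarrow> nat \<Rightarrow> complex" where
  "qint \<nu> n = (1 - \<nu> ^ n) / (1 - \<nu>)"

definition qfact :: "complex \<Rightarrow> nat \<Rightarrow> complex" where
  "qfact \<nu> n = (\<Prod>i=1..n. qint \<nu> i)"

definition shuffle_perms :: "nat \<Rightarrow> nat \<Rightarrow> (nat \<Rightarrow> nat) set" where
  "shuffle_perms m n =
     {w. w permutes {1..m + n} \<and> strict_mono_on {1..m} w \<and> strict_mono_on {m + 1..m + n} w}"

definition Sh_coeff :: "complex \<Rightarrow> nat \<Rightarrow> nat \<Rightarrow> complex" where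
  "Sh_coeff q m n =
     qfact (q powi (-2)) m * qfact (q powi (-2)) n / qfact (q powi (-2)) (m + n)"

definition Sh_plus ::
  "(('v, complex) tensor \<Rightarrow> ('v, complex) tensor) \<Rightarrow> complex \<Rightarrow> nat \<Rightarrow> nat \<Rightarrow>
   ('v, complex) tensor \<Rightarrow> ('v, complex) tensor" where
  "Sh_plus \<sigma> q m n t = Sh_coeff q m n \<cdot>\<^sub>T
     (\<Sum>w\<in>shuffle_perms m n. ((- q) powi (- int (perm_length (m + n) w))) \<cdot>\<^sub>T braid_perm \<sigma> (m + n) w t)"

definition Sh_minus ::
  "(('v, complex) tensor \<Rightarrow> ('v, complex) tensor) \<Rightarrow> complex \<Rightarrow> nat \<Rightarrow> nat \<Rightarrow>
   ('v, complex) tensor \<Rightarrow> ('v, complex) tensor" where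
  "Sh_minus \<sigma> q m n t = Sh_coeff q m n \<cdot>\<^sub>T
     (\<Sum>w\<in>shuffle_perms m n. ((- q) powi (- int (perm_length (m + n) w))) \<cdot>\<^sub>T braid_perm \<sigma> (m + n) (inv w) t)"

text \<open>
  The product of \<open>T(V)\<close> that is \<open>Sh_plus \<sigma> q m n (x \<otimes>\<^sub>T y)\<close> on homogeneous \<open>x\<close> and \<open>y\<close> of
  degrees \<open>m\<close> and \<open>n\<close>. If \<open>m = 0\<close> or \<open>n = 0\<close>, the identity is the only shuffle and this is scalar
  multiplication.
\<close>

definition shuffle_prod ::
  "(('v, complex) tensor \<Rightarrow> ('v, complex) tensor) \<Rightarrow> complex \<Rightarrow>
   ('v, complex) tensor \<Rightarrow> ('v, complex) tensor \<Rightarrow> ('v, complex) tensor" where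
  "shuffle_prod \<sigma> q x y = (\<lambda>w. \<Sum>m\<le>length w.
     Sh_plus \<sigma> q m (length w - m) (component m x \<otimes>\<^sub>T component (length w - m) y) w)"

inductive_set qext_algebra ::
  "'v set \<Rightarrow> (('v, complex) tensor \<Rightarrow> ('v, complex) tensor) \<Rightarrow> complex \<Rightarrow> ('v, complex) tensor set"
  for B \<sigma> q where
  one: "unit_tensor [] \<in> qext_algebra B \<sigma> q"
| gen: "x \<in> tensors B 1 \<Longrightarrow> x \<in> qext_algebra B \<sigma> q"
| add: "x \<in> qext_algebra B \<sigma> q \<Longrightarrow> y \<in> qext_algebra B \<sigma> q \<Longrightarrow> x + y \<in> qext_algebra B \<sigma> q"
| scale: "x \<in> qext_algebra B \<sigma> q \<Longrightarrow> c \<cdot>\<^sub>T x \<in> qext_algebra B \<sigma> q"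
| mult: "x \<in> qext_algebra B \<sigma> q \<Longrightarrow> y \<in> qext_algebra B \<sigma> q \<Longrightarrow>
    shuffle_prod \<sigma> q x y \<in> qext_algebra B \<sigma> q"

definition qext ::
  "'v set \<Rightarrow> (('v, complex) tensor \<Rightarrow> ('v, complex) tensor) \<Rightarrow> complex \<Rightarrow> nat \<Rightarrow> ('v, complex) tensor set" where
  "qext B \<sigma> q k = qext_algebra B \<sigma> q \<inter> tensors B k"

definition qext_dim ::
  "'v set \<Rightarrow> (('v, complex) tensor \<Rightarrow> ('v, complex) tensor) \<Rightarrow> complex \<Rightarrow> nat \<Rightarrow> nat" where
  "qext_dim B \<sigma> q k = tensor.dim (qext B \<sigma> q k)"

definition qext_basis ::
  "'v set \<Rightarrow> (('v, complex) tensor \<Rightarrow> ('v, complex) tensor) \<Rightarrow> complex \<Rightarrow> nat \<Rightarrow>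
   (nat \<Rightarrow> ('v, complex) tensor) \<Rightarrow> bool" where
  "qext_basis B \<sigma> q k e \<longleftrightarrow>
     inj_on e {1..qext_dim B \<sigma> q k} \<and>
     tensor.independent (e ` {1..qext_dim B \<sigma> q k}) \<and>
     tensor.span (e ` {1..qext_dim B \<sigma> q k}) = qext B \<sigma> q k"

definition qantisym ::
  "(('v, complex) tensor \<Rightarrow> ('v, complex) tensor) \<Rightarrow> complex \<Rightarrow> nat \<Rightarrow>
   ('v, complex) tensor \<Rightarrow> ('v, complex) tensor" where
  "qantisym \<sigma> q k t = (1 / qfact (q powi (-2)) k) \<cdot>\<^sub>T
     (\<Sum>w | w permutes {1..k}. ((- q) powi (- int (perm_length k w))) \<cdot>\<^sub>T braid_perm \<sigma> k w t)"

text \<open>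
  \<open>coprod B \<sigma> q m n\<close> is \<open>\<Delta>\<^sub>m\<^sub>,\<^sub>n\<close>: an element \<open>x\<close> of the exterior power \<open>m + n\<close> is written as
  \<open>qantisym \<sigma> q (m + n) y\<close> and sent to the image of \<open>y\<close> under \<open>Sh_minus \<sigma> q m n\<close> followed by
  \<open>qantisym \<sigma> q m \<otimes> qantisym \<sigma> q n\<close>; the result does not depend on the choice of \<open>y\<close>.
\<close>

definition coprod ::
  "'v set \<Rightarrow> (('v, complex) tensor \<Rightarrow> ('v, complex) tensor) \<Rightarrow> complex \<Rightarrow> nat \<Rightarrow> nat \<Rightarrow>
   ('v, complex) tensor \<Rightarrow> ('v, complex) tensor" where
  "coprod B \<sigma> q m n x =
     tensor_lift (tensors B m) (tensors B n) (\<lambda>y z. qantisym \<sigma> q m y \<otimes>\<^sub>T qantisym \<sigma> q n z)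
       (Sh_minus \<sigma> q m n (SOME y. y \<in> tensors B (m + n) \<and> qantisym \<sigma> q (m + n) y = x))"

text \<open>Complex associative algebras; no unit is required.\<close>

locale complex_assoc_algebra = vector_space sc
  for sc :: "complex \<Rightarrow> 'a::ring \<Rightarrow> 'a" +
  assumes scale_mult_left: "sc c a * b = sc c (a * b)"
    and scale_mult_right: "a * sc c b = sc c (a * b)"

definition vscale :: "(complex \<Rightarrow> 'a \<Rightarrow> 'a) \<Rightarrow> complex \<Rightarrow> ('v, 'a) tensor \<Rightarrow> ('v, 'a) tensor" where
  "vscale sc c P = (\<lambda>w. sc c (P w))"

definition vtensor :: "(complex \<Rightarrow> 'a \<Rightarrow> 'a) \<Rightarrow> ('v, complex) tensor \<Rightarrow> 'a \<Rightarrow> ('v, 'a) tensor" where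
  "vtensor sc x a = (\<lambda>w. sc (x w) a)"

text \<open>
  The product \<open>(\<alpha> \<otimes> a) \<cdot> (\<beta> \<otimes> b) = (\<alpha> \<odot> \<beta>) \<otimes> ab\<close>, extended bilinearly and written out in the
  word basis: \<open>P\<close> is the sum of the \<open>unit_tensor u \<otimes> P u\<close>, and likewise for \<open>Q\<close>.
\<close>

definition vprod ::
  "(complex \<Rightarrow> 'a::ring \<Rightarrow> 'a) \<Rightarrow> 'v set \<Rightarrow> (('v, complex) tensor \<Rightarrow> ('v, complex) tensor) \<Rightarrow> complex \<Rightarrow>
   ('v, 'a) tensor \<Rightarrow> ('v, 'a) tensor \<Rightarrow> ('v, 'a) tensor" where
  "vprod sc B \<sigma> q P Q = (\<lambda>w. \<Sum>m\<le>length w. \<Sum>u\<in>words B m. \<Sum>v\<in>words B (length w - m).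
     sc (shuffle_prod \<sigma> q (unit_tensor u) (unit_tensor v) w) (P u * Q v))"

text \<open>The convolution product \<open>\<cdot> (F \<otimes> G) \<Delta>\<^sub>m\<^sub>,\<^sub>n\<close> for \<open>F\<close> and \<open>G\<close> of degrees \<open>m\<close> and \<open>n\<close>.\<close>

definition conv ::
  "(complex \<Rightarrow> 'a::ring \<Rightarrow> 'a) \<Rightarrow> 'v set \<Rightarrow> (('v, complex) tensor \<Rightarrow> ('v, complex) tensor) \<Rightarrow> complex \<Rightarrow>
   nat \<Rightarrow> nat \<Rightarrow> (('v, complex) tensor \<Rightarrow> ('v, 'a) tensor) \<Rightarrow> (('v, complex) tensor \<Rightarrow> ('v, 'a) tensor) \<Rightarrow>
   ('v, complex) tensor \<Rightarrow> ('v, 'a) tensor" where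
  "conv sc B \<sigma> q m n F G x =
     tensor_lift (qext B \<sigma> q m) (qext B \<sigma> q n) (\<lambda>y z. vprod sc B \<sigma> q (F y) (G z)) (coprod B \<sigma> q m n x)"

text \<open>\<open>conv_pow_Suc \<dots> k F\<close> is the convolution power of exponent \<open>k + 1\<close>; exponent 0 would need a
  unit in the algebra.\<close>

primrec conv_pow_Suc ::
  "(complex \<Rightarrow> 'a::ring \<Rightarrow> 'a) \<Rightarrow> 'v set \<Rightarrow> (('v, complex) tensor \<Rightarrow> ('v, complex) tensor) \<Rightarrow> complex \<Rightarrow>
   nat \<Rightarrow> (('v, complex) tensor \<Rightarrow> ('v, 'a) tensor) \<Rightarrow> ('v, complex) tensor \<Rightarrow> ('v, 'a) tensor" where
  "conv_pow_Suc sc B \<sigma> q 0 F = F"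
| "conv_pow_Suc sc B \<sigma> q (Suc k) F = conv sc B \<sigma> q (Suc k) 1 (conv_pow_Suc sc B \<sigma> q k F) F"

definition conv_pow ::
  "(complex \<Rightarrow> 'a::ring \<Rightarrow> 'a) \<Rightarrow> 'v set \<Rightarrow> (('v, complex) tensor \<Rightarrow> ('v, complex) tensor) \<Rightarrow> complex \<Rightarrow>
   nat \<Rightarrow> (('v, complex) tensor \<Rightarrow> ('v, 'a) tensor) \<Rightarrow> ('v, complex) tensor \<Rightarrow> ('v, 'a) tensor" where
  "conv_pow sc B \<sigma> q k F = conv_pow_Suc sc B \<sigma> q (k - 1) F"

text \<open>
  A linear map \<open>F\<close> from \<open>V\<close> to \<open>V \<otimes> A\<close> as a map on the first exterior power, which is the first
  tensor power: \<open>x\<close> corresponds to the vector with coordinates \<open>x [b]\<close>.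
\<close>

definition degree_one_map ::
  "(complex \<Rightarrow> 'v::ab_group_add \<Rightarrow> 'v) \<Rightarrow> 'v set \<Rightarrow> ('v \<Rightarrow> ('v, 'a) tensor) \<Rightarrow>
   ('v, complex) tensor \<Rightarrow> ('v, 'a) tensor" where
  "degree_one_map scV B F x = F (\<Sum>b\<in>B. scV (x [b]) b)"

text \<open>\<open>qminor \<dots> \<omega> F k i j\<close> is \<open>\<xi>(F,k)\<close> with lower index \<open>i\<close> and upper index \<open>j\<close>.\<close>

definition qminor ::
  "(complex \<Rightarrow> 'a::ring \<Rightarrow> 'a) \<Rightarrow> 'v set \<Rightarrow> (('v, complex) tensor \<Rightarrow> ('v, complex) tensor) \<Rightarrow> complex \<Rightarrow>
   (nat \<Rightarrow> nat \<Rightarrow> ('v, complex) tensor) \<Rightarrow> (('v, complex) tensor \<Rightarrow> ('v, 'a) tensor) \<Rightarrow>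
   nat \<Rightarrow> nat \<Rightarrow> nat \<Rightarrow> 'a" where
  "qminor sc B \<sigma> q \<omega> F k i j =
     (THE a. \<exists>c. conv_pow sc B \<sigma> q k F (\<omega> k i) = (\<Sum>l=1..qext_dim B \<sigma> q k. vtensor sc (\<omega> k l) (c l))
               \<and> c j = a)"

end

theory Submission
  imports Defs
begin

text \<open>
  Every permutation of \<open>m + n\<close> letters is uniquely a shuffle times a permutation preserving the two
  blocks, and lengths add. By Matsumoto's theorem the antisymmetrizer therefore factors as
  \<open>A\<^sup>m\<^sup>+\<^sup>n = Sh\<^sup>+ (A\<^sup>m \<otimes> A\<^sup>n) = (A\<^sup>m \<otimes> A\<^sup>n) Sh\<^sup>-\<close>. The first factorization identifies the exterior powers
  with the images of the antisymmetrizers and makes their product associative; the second says that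
  the coproduct is the inclusion into the tensor product, i.e. deconcatenation of words. Hence the
  convolution power \<open>k\<close> of \<open>F\<close> sends \<open>x\<close> to the sum of \<open>x(w) F(w\<^sub>1) \<cdots> F(w\<^sub>k)\<close> over all words \<open>w\<close>, which
  is multiplicative under splitting words, and the formula is this multiplicativity in coordinates.
\<close>

section \<open>Inversions and shuffles\<close>

text \<open>Permutation operators, the coproduct and the maps \<open>tensor_lift\<close> are defined
  through \<open>SOME\<close>: a reduced expression, a preimage, a decomposition into pure tensors.
  For each of them an admissible choice must first be shown to exist, and then a value found that
  does not mention it. The delicate case is convolution, whose decomposition has to stay inside the
  smaller exterior powers; the factorization of the antisymmetrizer through Sh^- supplies one.

  That factorization is the one through Sh^+ read through inverses: p = w y becomes p^(-1) = y^(-1)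
  w^(-1), where y^(-1) is again in the Young subgroup and inversion preserves length. The
  normalizing constants can be divided out because quantum factorials are nonzero for generic
  \<open>q\<close>.

  The algebra may have no unit, so products are taken along nonempty words only. Their associativity
  is derived from the antisymmetrizer and therefore established for tensor parts in exterior powers,
  which is why membership in these is tracked for all values of \<open>F\<close> and their
  products.\<close>

definition inversions :: "(nat \<Rightarrow> nat) \<Rightarrow> (nat \<times> nat) set" where
  "inversions w = {(a, b). a < b \<and> w b < w a}"

text \<open>Inversions are counted among all naturals, so the count of a permutation of {1..m} stays
  the same inside a larger symmetric group. It replaces the length, a minimum over expressions,
  because additivity can be checked on it pair by pair.\<close>

definition inv_num :: "(nat \<Rightarrow> nat) \<Rightarrow> nat" where
  "inv_num w = card (inversions w)"

lemma finite_inversions: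
  assumes "w permutes {1..n}"
  shows "finite (inversions w)"
proof -
  have "a \<in> {1..n} \<and> b \<in> {1..n}" if "a < b" "w b < w a" for a b
  proof -
    have *: "w x = x \<or> (1 \<le> w x \<and> w x \<le> n \<and> 1 \<le> x \<and> x \<le> n)" for x
      using permutes_in_image[OF assms, of x] permutes_not_in[OF assms, of x] by auto
    show ?thesis
      using *[of a] *[of b] that permutes_not_in[OF assms, of a] permutes_not_in[OF assms, of b]
      by (auto simp: not_le)
  qed
  then have "inversions w \<subseteq> {1..n} \<times> {1..n}"
    by (auto simp: inversions_def)
  then show ?thesis
    by (rule finite_subset) simp
qed

text \<open>The hypothesis says that \<open>x\<close> undoes no inversion of \<open>y\<close>, so
  these persist in \<open>x \<circ> y\<close>. The remaining inversions of the composite are pairs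
  kept in order by \<open>y\<close>, and applying \<open>y\<close> to both entries matches them with
  the inversions of \<open>x\<close>.\<close>

lemma inv_num_comp:
  assumes x: "x permutes {1..n}" and y: "y permutes {1..n}"
    and less: "\<And>a b. a < b \<Longrightarrow> y b < y a \<Longrightarrow> x (y b) < x (y a)"
  shows "inv_num (x \<circ> y) = inv_num x + inv_num y"
proof -
  define Z where "Z = {(a, b). a < b \<and> y a < y b \<and> x (y b) < x (y a)}"
  have inj: "y a = y b \<longleftrightarrow> a = b" for a b
    using permutes_inj[OF y] by (auto dest: injD)
  have split: "inversions (x \<circ> y) = Z \<union> inversions y"
    unfolding inversions_def Z_def
  proof (intro equalityI subsetI; clarsimp)
    fix a b assume "a < b" "x (y b) < x (y a)" "\<not> y b < y a"
    then show "y a < y b"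
      using inj[of a b] by auto
  qed (use less in blast)
  have disj: "Z \<inter> inversions y = {}"
    by (auto simp: Z_def inversions_def)
  have bij: "bij_betw (\<lambda>(a, b). (y a, y b)) Z (inversions x)"
  proof (rule bij_betw_imageI)
    show "inj_on (\<lambda>(a, b). (y a, y b)) Z"
      by (auto simp: inj_on_def inj)
    show "(\<lambda>(a, b). (y a, y b)) ` Z = inversions x"
    proof (intro equalityI subsetI)
      fix z assume "z \<in> inversions x"
      then obtain c d where z: "z = (c, d)" "c < d" "x d < x c"
        by (auto simp: inversions_def)
      obtain a b where ab: "y a = c" "y b = d"
        using permutes_surj[OF y] by (metis surjD)
      have "a < b"
        using z ab less[of b a] by (metis inj linorder_neqE_nat not_less_iff_gr_or_eq)
      then show "z \<in> (\<lambda>(a, b). (y a, y b)) ` Z"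
        using z ab by (force simp: Z_def)
    qed (auto simp: Z_def inversions_def)
  qed
  have "finite (inversions (x \<circ> y))"
    using finite_inversions permutes_compose[OF y x] by blast
  then show ?thesis
    unfolding inv_num_def split
    using bij_betw_same_card[OF bij] disj by (simp add: card_Un_disjoint)
qed

lemma inv_num_inv:
  assumes w: "w permutes {1..n}"
  shows "inv_num (inv w) = inv_num w"
proof -
  have "bij_betw (\<lambda>(a, b). (w b, w a)) (inversions w) (inversions (inv w))"
  proof (rule bij_betw_byWitness[where f' = "\<lambda>(a, b). (inv w b, inv w a)"])
  qed (auto simp: inversions_def permutes_inverses[OF w])
  from bij_betw_same_card[OF this] show ?thesis
    by (simp add: inv_num_def)
qed

lemma inv_num_id [simp]: "inv_num id = 0"
proof -
  have "inversions id = {}"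
    by (auto simp: inversions_def)
  then show ?thesis
    by (simp add: inv_num_def)
qed

text \<open>A left descent: composing with the transposition on the left exchanges the values i and
  i + 1, so their positions decide whether the length drops.\<close>

abbreviation descent :: "nat \<Rightarrow> (nat \<Rightarrow> nat) \<Rightarrow> bool" where
  "descent i w \<equiv> inv w (Suc i) < inv w i"

lemma transpose_permutes:
  assumes "i \<in> {1..<n}"
  shows "transpose i (Suc i) permutes {1..n}"
  using assms by (intro permutes_swap_id) auto

text \<open>The transposition has the single inversion (i, i + 1). It could only undo an inversion
  of \<open>w\<close> whose two values are i and i + 1, and that would be a descent at i; hence
  \<open>inv_num_comp\<close> applies.\<close>

lemma inv_num_transpose_comp_ascent:
  assumes w: "w permutes {1..n}" and i: "i \<in> {1..<n}" and asc: "\<not> descent i w"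
  shows "inv_num (transpose i (Suc i) \<circ> w) = Suc (inv_num w)"
proof -
  have "inversions (transpose i (Suc i)) = {(i, Suc i)}"
    by (auto simp: inversions_def transpose_def split: if_splits)
  then have one: "inv_num (transpose i (Suc i)) = 1"
    by (simp add: inv_num_def)
  have "inv_num (transpose i (Suc i) \<circ> w) = inv_num (transpose i (Suc i)) + inv_num w"
  proof (rule inv_num_comp[OF transpose_permutes[OF i] w])
    fix a b assume ab: "a < b" "w b < w a"
    have "\<not> (w b = i \<and> w a = Suc i)"
      using ab asc permutes_inverses(2)[OF w, of a] permutes_inverses(2)[OF w, of b] by auto
    then show "transpose i (Suc i) (w b) < transpose i (Suc i) (w a)"
      using ab(2) by (auto simp: transpose_def)
  qed
  then show ?thesis
    using one by simp
qed

lemma inv_transpose_comp: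
  assumes "w permutes {1..n}"
  shows "inv (transpose i (Suc i) \<circ> w) = inv w \<circ> transpose i (Suc i)"
  using assms by (simp add: o_inv_distrib permutes_bij)

lemma inv_num_transpose_comp_descent:
  assumes w: "w permutes {1..n}" and i: "i \<in> {1..<n}" and desc: "descent i w"
  shows "inv_num w = Suc (inv_num (transpose i (Suc i) \<circ> w))"
proof -
  have "transpose i (Suc i) \<circ> w permutes {1..n}"
    using permutes_compose[OF w transpose_permutes[OF i]] .
  from inv_num_transpose_comp_ascent[OF this i] show ?thesis
    using desc by (simp add: inv_transpose_comp[OF w] flip: o_assoc)
      (simp add: o_assoc)
qed

text \<open>Consider the least element moved. If it goes down, its image is already fixed, against
  injectivity; if it goes up, monotonicity leaves nothing that could map to it.\<close>

lemma strict_mono_on_image_eq: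
  fixes u :: "nat \<Rightarrow> nat"
  assumes image: "u ` S = S" and mono: "strict_mono_on S u" and "x \<in> S"
  shows "u x = x"
  using \<open>x \<in> S\<close>
proof (induction x rule: less_induct)
  case (less x)
  obtain z where z: "z \<in> S" "u z = x"
    using image less.prems by (metis imageE)
  have ux: "u x \<in> S"
    using image less.prems by blast
  consider "u x < x" | "u x > x" | "u x = x"
    by linarith
  then show ?case
  proof cases
    case 1
    then have "u (u x) = u x"
      using less.IH ux by blast
    then show ?thesis
      using strict_mono_on_imp_inj_on[OF mono] ux less.prems by (auto dest: inj_onD)
  next
    case 2
    then show ?thesis
      using z less.IH[of z] less.prems mono
      by (metis linorder_neqE_nat order_less_asym strict_mono_onD)
  qed
qed

lemma strict_mono_permutes_eq_id:
  fixes u :: "nat \<Rightarrow> nat"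
  assumes u: "u permutes S" and mono: "strict_mono_on S u"
  shows "u = id"
proof
  show "u x = id x" for x
    using strict_mono_on_image_eq[OF permutes_image[OF u] mono] permutes_not_in[OF u]
    by (cases "x \<in> S") auto
qed

lemma strict_mono_onI_Suc:
  fixes f :: "nat \<Rightarrow> nat"
  assumes "\<And>i. a \<le> i \<Longrightarrow> i < b \<Longrightarrow> f i < f (Suc i)"
  shows "strict_mono_on {a..b} f"
proof (rule strict_mono_onI)
  fix r s :: nat
  assume "r \<in> {a..b}" "s \<in> {a..b}" "r < s"
  from \<open>r < s\<close> have "r \<ge> a \<Longrightarrow> s \<le> b \<Longrightarrow> f r < f s"
  proof (induction rule: less_Suc_induct)
    case (2 i j k)
    then show ?case by (meson le_trans less_imp_le order_less_trans)
  qed (use assms in auto)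
  then show "f r < f s"
    using \<open>r \<in> {a..b}\<close> \<open>s \<in> {a..b}\<close> by auto
qed

text \<open>Without descents the inverse increases on the whole interval, and an increasing
  permutation is the identity.\<close>

lemma ex_descent:
  assumes w: "w permutes {1..n}" and ne: "w \<noteq> id"
  obtains i where "i \<in> {1..<n}" "descent i w"
proof (rule ccontr)
  assume no: "\<not> thesis"
  have "inv w i < inv w (Suc i)" if "1 \<le> i" "i < n" for i
  proof -
    have "\<not> descent i w"
      using no that \<open>_ \<Longrightarrow> _ \<Longrightarrow> thesis\<close> by auto
    moreover have "inv w i \<noteq> inv w (Suc i)"
      using permutes_inj[OF permutes_inv[OF w]] by (metis injD n_not_Suc_n)
    ultimately show ?thesis by linarith
  qed
  then have "strict_mono_on {1..n} (inv w)"
    by (rule strict_mono_onI_Suc)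
  then have "inv w = id"
    using strict_mono_permutes_eq_id permutes_inv[OF w] by blast
  then show False
    using ne permutes_inv_inv[OF w] by (metis inv_id)
qed

section \<open>Expressions, length and reduced expressions\<close>

lemma expression_Nil [simp]: "expression n w [] \<longleftrightarrow> w = id"
  by (auto simp: expression_def)

lemma expression_Cons:
  "expression n w (i # is) \<longleftrightarrow>
     i \<in> {1..<n} \<and> (\<exists>v. expression n v is \<and> w = transpose i (Suc i) \<circ> v)"
  by (auto simp: expression_def)

lemma expression_append:
  "expression n v is \<Longrightarrow> expression n w js \<Longrightarrow> expression n (v \<circ> w) (is @ js)"
proof (induction "is" arbitrary: v)
  case (Cons i "is")
  then obtain v' where v': "i \<in> {1..<n}" "expression n v' is" "v = transpose i (Suc i) \<circ> v'"
    by (auto simp: expression_Cons)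
  then have "expression n (v' \<circ> w) (is @ js)"
    using Cons by blast
  moreover have "v \<circ> w = transpose i (Suc i) \<circ> (v' \<circ> w)"
    by (simp only: v'(3) comp_assoc)
  ultimately show ?case
    using v'(1) by (auto simp only: expression_Cons append_Cons)
qed simp

lemma expression_permutes: "expression n w is \<Longrightarrow> w permutes {1..n}"
proof (induction "is" arbitrary: w)
  case (Cons i "is")
  then show ?case
    using permutes_compose transpose_permutes by (metis expression_Cons)
qed (auto simp: permutes_id)

lemma inv_num_le_length: "expression n w is \<Longrightarrow> inv_num w \<le> length is"
proof (induction "is" arbitrary: w)
  case (Cons i "is")
  then obtain v where v: "i \<in> {1..<n}" "expression n v is" "w = transpose i (Suc i) \<circ> v"
    by (auto simp: expression_Cons)
  then have "inv_num v \<le> length is"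
    using Cons by blast
  moreover have "inv_num w \<le> Suc (inv_num v)"
    using v expression_permutes inv_num_transpose_comp_ascent inv_num_transpose_comp_descent
    by (metis Suc_leD le_SucI lessI less_or_eq_imp_le nle_le)
  ultimately show ?case by simp
qed simp

text \<open>Sorting: cancelling a left descent lowers the number of inversions by one, and the
  process stops only at the identity.\<close>

lemma ex_expression:
  assumes "w permutes {1..n}"
  shows "\<exists>is. expression n w is \<and> length is = inv_num w"
  using assms
proof (induction "inv_num w" arbitrary: w rule: less_induct)
  case less
  show ?case
  proof (cases "w = id")
    case False
    then obtain i where i: "i \<in> {1..<n}" "descent i w"
      using ex_descent less.prems by blast
    let ?v = "transpose i (Suc i) \<circ> w"
    have v: "?v permutes {1..n}" "inv_num w = Suc (inv_num ?v)"
      using permutes_compose[OF less.prems transpose_permutes[OF i(1)]]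
        inv_num_transpose_comp_descent[OF less.prems i] by auto
    then obtain "is" where "is": "expression n ?v is" "length is = inv_num ?v"
      using less.hyps[of ?v] by auto
    have "w = transpose i (Suc i) \<circ> ?v"
      by (simp add: o_assoc)
    then have "expression n w (i # is)"
      using i "is" by (auto simp: expression_Cons)
    then show ?thesis
      using "is" v by (intro exI[of _ "i # is"]) simp
  qed (intro exI[of _ "[]"], simp)
qed

text \<open>A letter creates at most one inversion, so inversions bound the number of letters from
  below; sorting attains the bound.\<close>

lemma perm_length_eq_inv_num:
  assumes "w permutes {1..n}"
  shows "perm_length n w = inv_num w"
  unfolding perm_length_def
  using ex_expression[OF assms] inv_num_le_length by (intro Least_equality) auto

lemma reduced_expression_iff:
  "reduced_expression n w is \<longleftrightarrow> expression n w is \<and> length is = inv_num w"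
  unfolding reduced_expression_def using expression_permutes perm_length_eq_inv_num by metis

lemma ex_reduced_expression:
  "w permutes {1..n} \<Longrightarrow> \<exists>is. reduced_expression n w is"
  using ex_expression by (simp add: reduced_expression_iff)

lemma reduced_expression_append:
  assumes "reduced_expression n v is" "reduced_expression n w js"
    and "inv_num (v \<circ> w) = inv_num v + inv_num w"
  shows "reduced_expression n (v \<circ> w) (is @ js)"
  using assms expression_append by (auto simp: reduced_expression_iff)

lemma reduced_expression_ConsI:
  assumes w: "w permutes {1..n}" and i: "i \<in> {1..<n}" "descent i w"
    and v: "reduced_expression n (transpose i (Suc i) \<circ> w) is"
  shows "reduced_expression n w (i # is)"
proof -
  have "w = transpose i (Suc i) \<circ> (transpose i (Suc i) \<circ> w)"
    by (simp add: o_assoc)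
  then show ?thesis
    using v i inv_num_transpose_comp_descent[OF w i]
    by (auto simp: reduced_expression_iff expression_Cons)
qed

text \<open>If i were an ascent of \<open>w\<close>, then
  \<open>transpose i (Suc i) \<circ> w\<close> would have one inversion more than \<open>w\<close>;
  yet the tail \<open>is\<close> expresses it with one letter fewer than \<open>w\<close> has
  inversions.\<close>

lemma reduced_expression_ConsD:
  assumes "reduced_expression n w (i # is)"
  shows "i \<in> {1..<n}" "descent i w" "reduced_expression n (transpose i (Suc i) \<circ> w) is"
proof -
  obtain v where v: "i \<in> {1..<n}" "expression n v is" "w = transpose i (Suc i) \<circ> v"
    and len: "Suc (length is) = inv_num w"
    using assms by (auto simp: reduced_expression_iff expression_Cons)
  have sw: "transpose i (Suc i) \<circ> w = v"
    by (simp add: v o_assoc)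
  have w: "w permutes {1..n}"
    using assms expression_permutes by (auto simp: reduced_expression_def)
  have le: "inv_num v \<le> length is"
    using inv_num_le_length v by blast
  show "i \<in> {1..<n}" by fact
  show desc: "descent i w"
    using inv_num_transpose_comp_ascent[OF w v(1)] sw le len by fastforce
  show "reduced_expression n (transpose i (Suc i) \<circ> w) is"
    using inv_num_transpose_comp_descent[OF w v(1) desc] sw len v
    by (simp add: reduced_expression_iff)
qed

section \<open>The Young subgroup S_m x S_n and its shuffle coset representatives\<close>

definition shift_perm :: "nat \<Rightarrow> (nat \<Rightarrow> nat) \<Rightarrow> nat \<Rightarrow> nat" where
  "shift_perm m v = (\<lambda>i. if i \<le> m then i else v (i - m) + m)"

lemma shift_perm_id [simp]: "shift_perm m id = id"
  by (auto simp: shift_perm_def fun_eq_iff)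

lemma shift_perm_comp:
  assumes "w permutes {1..n}"
  shows "shift_perm m (v \<circ> w) = shift_perm m v \<circ> shift_perm m w"
proof -
  \<comment> \<open>As \<open>w\<close> fixes 0, it keeps positive numbers positive: the inner map
    sends numbers above m to numbers above m, and the outer map enters the same branch.\<close>
  have pos: "w (x - m) \<noteq> 0" if "\<not> x \<le> m" for x
    using permutes_in_image[OF assms, of "x - m"] permutes_not_in[OF assms, of "x - m"] that
    by (cases "x - m \<in> {1..n}") auto
  show ?thesis
  proof
    show "shift_perm m (v \<circ> w) x = (shift_perm m v \<circ> shift_perm m w) x" for x
      using pos[of x] by (auto simp: shift_perm_def)
  qed
qed

lemma shift_perm_permutes:
  assumes v: "v permutes {1..n}"
  shows "shift_perm m v permutes {m + 1..m + n}"
proof (rule bij_imp_permutes)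
  have img: "v i \<in> {1..n}" "inv v i \<in> {1..n}" if "i \<in> {1..n}" for i
    using permutes_in_image[OF v] permutes_in_image[OF permutes_inv[OF v]] that by auto
  show "bij_betw (shift_perm m v) {m + 1..m + n} {m + 1..m + n}"
  proof (rule bij_betw_byWitness[where f' = "shift_perm m (inv v)"])
    have *: "shift_perm m (inv v) (shift_perm m v a) = a \<and> shift_perm m v (shift_perm m (inv v) a) = a \<and>
        shift_perm m v a \<in> {m + 1..m + n} \<and> shift_perm m (inv v) a \<in> {m + 1..m + n}"
      if "a \<in> {m + 1..m + n}" for a
    proof -
      have "a - m \<in> {1..n}"
        using that by auto
      from img[OF this] show ?thesis
        using that by (auto simp: shift_perm_def permutes_inverses[OF v])
    qed
    show "\<forall>a\<in>{m + 1..m + n}. shift_perm m (inv v) (shift_perm m v a) = a"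
      "\<forall>a\<in>{m + 1..m + n}. shift_perm m v (shift_perm m (inv v) a) = a"
      "shift_perm m v ` {m + 1..m + n} \<subseteq> {m + 1..m + n}"
      "shift_perm m (inv v) ` {m + 1..m + n} \<subseteq> {m + 1..m + n}"
      using * by blast+
  qed
  show "shift_perm m v i = i" if "i \<notin> {m + 1..m + n}" for i
  proof (cases "i \<le> m")
    case False
    then have "i - m \<notin> {1..n}" "i - m + m = i"
      using that by auto
    then show ?thesis
      using False permutes_not_in[OF v] by (auto simp: shift_perm_def)
  qed (simp add: shift_perm_def)
qed

lemma shift_perm_permutes':
  "v permutes {1..n} \<Longrightarrow> shift_perm m v permutes {1..m + n}"
  by (rule permutes_subset[OF shift_perm_permutes]) auto

lemma inv_num_shift_perm:
  assumes v: "v permutes {1..n}"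
  shows "inv_num (shift_perm m v) = inv_num v"
proof -
  have pos: "v i \<ge> 1 \<longleftrightarrow> i \<ge> 1" for i
    using permutes_in_image[OF v, of i] permutes_not_in[OF v, of i] by auto
  have v0: "v 0 = 0"
    using permutes_not_in[OF v, of 0] by simp
  have "bij_betw (\<lambda>(a, b). (a + m, b + m)) (inversions v) (inversions (shift_perm m v))"
  proof (rule bij_betw_byWitness[where f' = "\<lambda>(a, b). (a - m, b - m)"])
    \<comment> \<open>An inversion of the shifted permutation lies entirely above m, so truncated
      subtraction of m loses nothing.\<close>
    have *: "m < a \<and> m < b" if "a < b" "shift_perm m v b < shift_perm m v a" for a b
      using that pos[of "a - m"] pos[of "b - m"] by (auto simp: shift_perm_def split: if_splits)
    show "\<forall>z\<in>inversions (shift_perm m v). (case case z of (a, b) \<Rightarrow> (a - m, b - m) of (a, b) \<Rightarrow> (a + m, b + m)) = z"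
      using * by (fastforce simp: inversions_def)
    show "(\<lambda>(a, b). (a - m, b - m)) ` inversions (shift_perm m v) \<subseteq> inversions v"
      using * by (fastforce simp: inversions_def shift_perm_def split: if_splits)
    show "(\<lambda>(a, b). (a + m, b + m)) ` inversions v \<subseteq> inversions (shift_perm m v)"
      using v0 by (auto simp: inversions_def shift_perm_def)
  qed auto
  from bij_betw_same_card[OF this] show ?thesis
    by (simp add: inv_num_def)
qed

lemma shift_perm_transpose:
  "shift_perm m (transpose i (Suc i)) = transpose (i + m) (Suc (i + m))" if "i \<ge> 1"
  using that by (auto simp: shift_perm_def transpose_def fun_eq_iff)

lemma expression_shift_perm:
  "expression n v is \<Longrightarrow> expression (m + n) (shift_perm m v) (map (\<lambda>i. i + m) is)"
proof (induction "is" arbitrary: v)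
  case (Cons i "is")
  then obtain v' where v': "i \<in> {1..<n}" "expression n v' is" "v = transpose i (Suc i) \<circ> v'"
    by (auto simp: expression_Cons)
  then have "shift_perm m v = transpose (i + m) (Suc (i + m)) \<circ> shift_perm m v'"
    using shift_perm_comp[OF expression_permutes] shift_perm_transpose[of i m] by auto
  then show ?case
    using Cons.IH[OF v'(2)] v'(1) unfolding list.map expression_Cons by auto
qed simp

lemma reduced_expression_shift_perm:
  assumes "reduced_expression n v is"
  shows "reduced_expression (m + n) (shift_perm m v) (map (\<lambda>i. i + m) is)"
  using assms expression_shift_perm inv_num_shift_perm expression_permutes
  by (fastforce simp: reduced_expression_iff)

lemma reduced_expression_mono:
  assumes "reduced_expression m u is"
  shows "reduced_expression (m + n) u is"
  using assms by (auto simp: reduced_expression_iff expression_def)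

lemma young_block_eq:
  assumes u: "u permutes {1..m}" and v: "v permutes {1..n}"
  shows "i \<in> {1..m} \<Longrightarrow> (u \<circ> shift_perm m v) i = u i \<and> u i \<in> {1..m}"
    and "i \<in> {m+1..m+n} \<Longrightarrow> (u \<circ> shift_perm m v) i = shift_perm m v i \<and> shift_perm m v i \<in> {m+1..m+n}"
proof -
  show "i \<in> {1..m} \<Longrightarrow> (u \<circ> shift_perm m v) i = u i \<and> u i \<in> {1..m}"
    using permutes_in_image[OF u, of i] by (auto simp: shift_perm_def)
  assume "i \<in> {m+1..m+n}"
  then show "(u \<circ> shift_perm m v) i = shift_perm m v i \<and> shift_perm m v i \<in> {m+1..m+n}"
    using permutes_in_image[OF shift_perm_permutes[OF v], of m i]
      permutes_not_in[OF u, of "shift_perm m v i"] by auto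
qed

lemma young_permutes:
  assumes u: "u permutes {1..m}" and v: "v permutes {1..n}"
  shows "u \<circ> shift_perm m v permutes {1..m + n}"
proof -
  have "u permutes {1..m + n}"
    by (rule permutes_subset[OF u]) auto
  then show ?thesis
    using permutes_compose shift_perm_permutes'[OF v] by blast
qed

lemma inv_num_young:
  assumes u: "u permutes {1..m}" and v: "v permutes {1..n}"
  shows "inv_num (u \<circ> shift_perm m v) = inv_num u + inv_num v"
proof -
  have "u permutes {1..m + n}"
    by (rule permutes_subset[OF u]) auto
  have "inv_num (u \<circ> shift_perm m v) = inv_num u + inv_num (shift_perm m v)"
  proof (rule inv_num_comp[OF \<open>u permutes {1..m + n}\<close> shift_perm_permutes'[OF v]])
    fix a b assume ab: "a < b" "shift_perm m v b < shift_perm m v a"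
    have pos: "v i \<ge> 1 \<longleftrightarrow> i \<ge> 1" for i
      using permutes_in_image[OF v, of i] permutes_not_in[OF v, of i] by auto
    have "m < shift_perm m v a" "m < shift_perm m v b"
      using ab pos[of "a - m"] pos[of "b - m"] by (auto simp: shift_perm_def split: if_splits)
    then show "u (shift_perm m v b) < u (shift_perm m v a)"
      using ab permutes_not_in[OF u] by simp
  qed
  then show ?thesis
    using inv_num_shift_perm[OF v] by simp
qed

text \<open>The composite \<open>u \<circ> shift_perm m v\<close> runs through the Young subgroup.
  Its inversions are pairs inside one block, with values in that block, and \<open>w\<close>
  increases there, so \<open>w\<close> undoes none of them.\<close>

lemma inv_num_shuffle_young:
  assumes w: "w \<in> shuffle_perms m n" and u: "u permutes {1..m}" and v: "v permutes {1..n}"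
  shows "inv_num (w \<circ> (u \<circ> shift_perm m v)) = inv_num w + (inv_num u + inv_num v)"
proof -
  let ?y = "u \<circ> shift_perm m v"
  have w': "w permutes {1..m + n}" "strict_mono_on {1..m} w" "strict_mono_on {m + 1..m + n} w"
    using w by (auto simp: shuffle_perms_def)
  have y: "?y permutes {1..m + n}"
    using young_permutes[OF u v] .
  have "inv_num (w \<circ> ?y) = inv_num w + inv_num ?y"
  proof (rule inv_num_comp[OF w'(1) y])
    fix a b assume ab: "a < b" "?y b < ?y a"
    have "(a, b) \<in> {1..m + n} \<times> {1..m + n}"
    proof -
      have *: "?y x \<in> {1..m + n} \<longleftrightarrow> x \<in> {1..m + n}" "x \<notin> {1..m + n} \<Longrightarrow> ?y x = x" for x
        using permutes_in_image[OF y] permutes_not_in[OF y] by blast+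
      show ?thesis
        using *[of a] *[of b] ab by (cases "a \<in> {1..m + n}"; cases "b \<in> {1..m + n}") auto
    qed
    then consider "a \<in> {1..m}" "b \<in> {1..m}" | "a \<in> {1..m}" "b \<in> {m+1..m+n}"
      | "a \<in> {m+1..m+n}" "b \<in> {m+1..m+n}"
      using ab(1) by fastforce
    then show "w (?y b) < w (?y a)"
    proof cases
      case 1
      then show ?thesis
        using young_block_eq(1)[OF u v] ab(2) w'(2) by (metis strict_mono_onD)
    next
      case 2
      then show ?thesis
        using young_block_eq(1)[OF u v 2(1)] young_block_eq(2)[OF u v 2(2)] ab(2) by auto
    next
      case 3
      then show ?thesis
        using young_block_eq(2)[OF u v] ab(2) w'(3) by (metis strict_mono_onD)
    qed
  qed
  then show ?thesis
    using inv_num_young[OF u v] by simp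
qed

lemma permutes_commute_transpose:
  assumes u: "u permutes {1..m}" and "m < i"
  shows "transpose i (Suc i) \<circ> u = u \<circ> transpose i (Suc i)"
proof
  fix x
  have "x \<notin> {1..m} \<Longrightarrow> u x = x" "u x \<in> {1..m} \<longleftrightarrow> x \<in> {1..m}"
      "u i = i" "u (Suc i) = Suc i"
    using assms permutes_not_in[OF u] permutes_in_image[OF u] by auto
  then show "(transpose i (Suc i) \<circ> u) x = (u \<circ> transpose i (Suc i)) x"
    using \<open>m < i\<close> by (cases "x \<in> {1..m}") (auto simp: transpose_def)
qed

text \<open>A right descent is a left descent of the inverse, which has as many inversions.\<close>

lemma inv_num_comp_transpose:
  assumes w: "w permutes {1..n}" and i: "i \<in> {1..<n}" and desc: "w (Suc i) < w i"
  shows "inv_num w = Suc (inv_num (w \<circ> transpose i (Suc i)))"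
proof -
  have "descent i (inv w)"
    using desc permutes_inv_inv[OF w] by simp
  from inv_num_transpose_comp_descent[OF permutes_inv[OF w] i this] show ?thesis
    using inv_num_inv[OF w] inv_num_inv[OF permutes_compose[OF transpose_permutes[OF i] w]]
      o_inv_distrib[OF permutes_bij[OF w] permutes_bij[OF transpose_permutes[OF i]]] by simp
qed

text \<open>Among all factorizations p = w y with y in the Young subgroup, one with fewest
  inversions of \<open>w\<close> is taken. A descent of \<open>w\<close> at neighbours i, i + 1 of
  the same block could be moved into y, making \<open>w\<close> shorter; so \<open>w\<close>
  increases on both blocks.\<close>

lemma ex_shuffle_young:
  assumes p: "p permutes {1..m + n}"
  obtains w u v where "w \<in> shuffle_perms m n" "u permutes {1..m}" "v permutes {1..n}"
    "p = w \<circ> (u \<circ> shift_perm m v)"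
proof -
  define Q where "Q = (\<lambda>w. w permutes {1..m + n} \<and>
    (\<exists>u v. u permutes {1..m} \<and> v permutes {1..n} \<and> p = w \<circ> (u \<circ> shift_perm m v)))"
  have "Q p"
    unfolding Q_def using p by (auto intro!: exI[of _ id] simp: permutes_id)
  then obtain w where "Q w" and min: "\<And>w'. Q w' \<Longrightarrow> inv_num w \<le> inv_num w'"
    using ex_has_least_nat[of Q p inv_num] by auto
  then obtain u v where w: "w permutes {1..m + n}" and u: "u permutes {1..m}"
    and v: "v permutes {1..n}" and p_eq: "p = w \<circ> (u \<circ> shift_perm m v)"
    by (auto simp: Q_def)
  have asc: "w i < w (Suc i)" if i: "i \<in> {1..<m} \<or> i \<in> {m + 1..<m + n}" for i
  proof (rule ccontr)
    let ?s = "transpose i (Suc i)"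
    assume "\<not> w i < w (Suc i)"
    moreover have "w i \<noteq> w (Suc i)"
      using permutes_inj[OF w] by (metis injD n_not_Suc_n)
    ultimately have "w (Suc i) < w i"
      by simp
    moreover have i': "i \<in> {1..<m + n}"
      using i by auto
    ultimately have less: "inv_num (w \<circ> ?s) < inv_num w"
      using inv_num_comp_transpose[OF w] by simp
    have perm: "w \<circ> ?s permutes {1..m + n}"
      using permutes_compose[OF transpose_permutes[OF i'] w] .
    have "p = (w \<circ> ?s) \<circ> (?s \<circ> (u \<circ> shift_perm m v))"
      unfolding p_eq by (simp add: fun_eq_iff)
    moreover have "\<exists>u' v'. u' permutes {1..m} \<and> v' permutes {1..n} \<and>
      ?s \<circ> (u \<circ> shift_perm m v) = u' \<circ> shift_perm m v'"
    proof (cases "i < m")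
      case True
      then have "?s \<circ> u permutes {1..m}"
        using i permutes_compose[OF u transpose_permutes] by auto
      then show ?thesis
        using v by (intro exI[of _ "?s \<circ> u"] exI[of _ v]) (simp add: o_assoc)
    next
      case False
      then have im: "i - m \<in> {1..<n}" "m < i"
        using i by auto
      have "?s = shift_perm m (transpose (i - m) (Suc (i - m)))"
        using im shift_perm_transpose[of "i - m" m] by simp
      then have "?s \<circ> (u \<circ> shift_perm m v) = u \<circ> shift_perm m (transpose (i - m) (Suc (i - m)) \<circ> v)"
        using permutes_commute_transpose[OF u im(2)] shift_perm_comp[OF v] by (metis comp_assoc)
      then show ?thesis
        using u permutes_compose[OF v transpose_permutes[OF im(1)]] by blast
    qed
    ultimately have "Q (w \<circ> ?s)"
      unfolding Q_def using perm by metis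
    then show False
      using min less by (meson not_le)
  qed
  have "w \<in> shuffle_perms m n"
    unfolding shuffle_perms_def using w asc by (auto intro!: strict_mono_onI_Suc)
  then show thesis
    using that u v p_eq by blast
qed

text \<open>With y and y' the two Young factors, \<open>z\<close> = y' y^(-1) preserves both blocks
  and satisfies w = w' z. As \<open>w\<close> and \<open>w'\<close> increase on each block, so does
  \<open>z\<close>, which is therefore the identity.\<close>

lemma shuffle_young_unique:
  assumes w: "w \<in> shuffle_perms m n" and u: "u permutes {1..m}" and v: "v permutes {1..n}"
    and w': "w' \<in> shuffle_perms m n" and u': "u' permutes {1..m}" and v': "v' permutes {1..n}"
    and eq: "w \<circ> (u \<circ> shift_perm m v) = w' \<circ> (u' \<circ> shift_perm m v')"
  shows "w = w' \<and> u = u' \<and> v = v'"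
proof -
  let ?y = "u \<circ> shift_perm m v" and ?y' = "u' \<circ> shift_perm m v'"
  define z where "z = ?y' \<circ> inv ?y"
  have y: "?y permutes {1..m + n}" and y': "?y' permutes {1..m + n}"
    using young_permutes assms by blast+
  have ws: "w permutes {1..m + n}" "strict_mono_on {1..m} w" "strict_mono_on {m + 1..m + n} w"
      "w' permutes {1..m + n}" "strict_mono_on {1..m} w'" "strict_mono_on {m + 1..m + n} w'"
    using w w' by (auto simp: shuffle_perms_def)
  have wz: "w = w' \<circ> z"
    unfolding z_def o_assoc using eq
    by (metis comp_assoc comp_id permutes_inv_o(1)[OF y])
  have image: "(f \<circ> shift_perm m g) ` {1..m} = {1..m}"
      "(f \<circ> shift_perm m g) ` {m + 1..m + n} = {m + 1..m + n}"
    if f: "f permutes {1..m}" and g: "g permutes {1..n}" for f g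
  proof -
    have "(f \<circ> shift_perm m g) ` {1..m} = f ` {1..m}"
      using young_block_eq(1)[OF f g] by (intro image_cong) auto
    then show "(f \<circ> shift_perm m g) ` {1..m} = {1..m}"
      using permutes_image[OF f] by simp
    have "(f \<circ> shift_perm m g) ` {m + 1..m + n} = shift_perm m g ` {m + 1..m + n}"
      using young_block_eq(2)[OF f g] by (intro image_cong) auto
    then show "(f \<circ> shift_perm m g) ` {m + 1..m + n} = {m + 1..m + n}"
      using permutes_image[OF shift_perm_permutes[OF g]] by simp
  qed
  have fix_block: "z x = x" if S: "?y ` S = S" "?y' ` S = S" "strict_mono_on S w" "strict_mono_on S w'" "x \<in> S" for S x
  proof (rule strict_mono_on_image_eq[OF _ _ \<open>x \<in> S\<close>])
    have "inv ?y ` S = S"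
      using S(1) permutes_bij[OF y] by (metis bij_betw_def image_inv_f_f)
    then show img: "z ` S = S"
      using S(2) by (simp only: z_def image_comp[symmetric])
    show "strict_mono_on S z"
    proof (rule strict_mono_onI)
      fix r s assume rs: "r \<in> S" "s \<in> S" "r < s"
      then have "w' (z r) < w' (z s)"
        using S(3) wz by (metis comp_apply strict_mono_onD)
      moreover have "z r \<in> S" "z s \<in> S"
        using img rs by blast+
      ultimately show "z r < z s"
        using S(4) strict_mono_on_less by blast
    qed
  qed
  have "z x = x" for x
  proof (cases "x \<in> {1..m + n}")
    case True
    then have "x \<in> {1..m} \<or> x \<in> {m + 1..m + n}"
      by auto
    then show ?thesis
      using fix_block image[OF u v] image[OF u' v'] ws by metis
  next
    case False
    then show ?thesis
      using permutes_not_in permutes_compose[OF permutes_inv[OF y] y'] z_def by metis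
  qed
  then have z: "z = id"
    by auto
  have yy: "?y = ?y'"
    using z unfolding z_def by (metis comp_assoc comp_id id_comp permutes_inv_o(2)[OF y])
  have "u x = u' x" for x
  proof (cases "x \<in> {1..m}")
    case True
    then show ?thesis
      using young_block_eq(1)[OF u v True] young_block_eq(1)[OF u' v' True] yy by metis
  qed (use permutes_not_in u u' in metis)
  then have uu: "u = u'" by auto
  have "v x = v' x" for x
  proof (cases "x \<in> {1..n}")
    case True
    then have "x + m \<in> {m + 1..m + n}" by auto
    then have "shift_perm m v (x + m) = shift_perm m v' (x + m)"
      using young_block_eq(2)[OF u v] young_block_eq(2)[OF u' v'] yy by metis
    then show ?thesis
      using True by (simp add: shift_perm_def)
  qed (use permutes_not_in v v' in metis)
  then show ?thesis
    using wz z uu by auto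
qed

lemma bij_betw_shuffle_young:
  "bij_betw (\<lambda>(w, u, v). w \<circ> (u \<circ> shift_perm m v))
     (shuffle_perms m n \<times> {u. u permutes {1..m}} \<times> {v. v permutes {1..n}})
     {p. p permutes {1..m + n}}"
proof (rule bij_betw_imageI)
  show "inj_on (\<lambda>(w, u, v). w \<circ> (u \<circ> shift_perm m v))
     (shuffle_perms m n \<times> {u. u permutes {1..m}} \<times> {v. v permutes {1..n}})"
    using shuffle_young_unique by (fastforce intro!: inj_onI)
  have "w \<circ> (u \<circ> shift_perm m v) permutes {1..m + n}"
    if "w \<in> shuffle_perms m n" "u permutes {1..m}" "v permutes {1..n}" for w u v
    using that permutes_compose[OF young_permutes] by (auto simp: shuffle_perms_def)
  then show "(\<lambda>(w, u, v). w \<circ> (u \<circ> shift_perm m v)) `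
     (shuffle_perms m n \<times> {u. u permutes {1..m}} \<times> {v. v permutes {1..n}}) =
     {p. p permutes {1..m + n}}"
  proof (intro equalityI subsetI)
    fix p assume "p \<in> {p. p permutes {1..m + n}}"
    then obtain w u v where "w \<in> shuffle_perms m n" "u permutes {1..m}" "v permutes {1..n}"
      "p = w \<circ> (u \<circ> shift_perm m v)"
      using ex_shuffle_young by blast
    then show "p \<in> (\<lambda>(w, u, v). w \<circ> (u \<circ> shift_perm m v)) `
        (shuffle_perms m n \<times> {u. u permutes {1..m}} \<times> {v. v permutes {1..n}})"
      by (intro rev_image_eqI[of "(w, u, v)"]) auto
  qed auto
qed

section \<open>Tensors and braid operators\<close>

lemma sum_fun_apply: "sum f A w = (\<Sum>i\<in>A. f i w)"
  by (induction A rule: infinite_finite_induct) auto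

lemma words_append:
  "u @ v \<in> words B (m + n) \<longleftrightarrow> u \<in> words B m \<and> v \<in> words B n" if "length u = m"
  using that by (auto simp: words_def)

lemma finite_words: "finite B \<Longrightarrow> finite (words B n)"
  using finite_lists_length_eq[of B n] by (simp add: words_def)

lemma bij_betw_words_append:
  "bij_betw (\<lambda>(u, v). u @ v) (words B m \<times> words B n) (words B (m + n))"
  by (rule bij_betw_byWitness[where f' = "\<lambda>w. (take m w, drop m w)"])
    (auto simp: words_def dest: in_set_takeD in_set_dropD)

lemma sum_words_append:
  "(\<Sum>w\<in>words B (m + n). f w) = (\<Sum>u\<in>words B m. \<Sum>v\<in>words B n. f (u @ v))"
  using sum.reindex_bij_betw[OF bij_betw_words_append, of f]
  by (simp add: sum.cartesian_product case_prod_unfold)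

lemma tensors_zero: "0 \<in> tensors B n"
  by (simp add: tensors_def)

lemma tensors_add: "x \<in> tensors B n \<Longrightarrow> y \<in> tensors B n \<Longrightarrow> (x + y :: ('v, 'm::monoid_add) tensor) \<in> tensors B n"
  by (simp add: tensors_def)

lemma tensors_scale: "x \<in> tensors B n \<Longrightarrow> c \<cdot>\<^sub>T x \<in> tensors B n"
  by (simp add: tensors_def tscale_def)

lemma tensors_sum:
  "(\<And>i. i \<in> A \<Longrightarrow> f i \<in> tensors B n) \<Longrightarrow> (sum f A :: ('v, 'm::comm_monoid_add) tensor) \<in> tensors B n"
  by (induction A rule: infinite_finite_induct) (auto intro: tensors_add tensors_zero)

lemma tensors_eqD: "x \<in> tensors B n \<Longrightarrow> x w \<noteq> 0 \<Longrightarrow> w \<in> words B n"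
  by (auto simp: tensors_def)

lemma tensors_eqI:
  assumes "x \<in> tensors B n" "y \<in> tensors B n" "\<And>w. w \<in> words B n \<Longrightarrow> x w = y w"
  shows "x = y"
  using assms by (fastforce simp: tensors_def fun_eq_iff)

lemma unit_tensor_mem: "w \<in> words B n \<Longrightarrow> unit_tensor w \<in> tensors B n"
  by (auto simp: unit_tensor_def tensors_def)

lemma tensor_expansion:
  assumes "finite B" "t \<in> tensors B n"
  shows "t = (\<Sum>w\<in>words B n. t w \<cdot>\<^sub>T unit_tensor w)"
proof
  fix v
  have "(\<Sum>w\<in>words B n. t w \<cdot>\<^sub>T unit_tensor w) v = (\<Sum>w\<in>words B n. if w = v then t v else 0)"
    by (auto simp: sum_fun_apply tscale_def unit_tensor_def intro!: sum.cong)
  also have "\<dots> = t v"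
    using assms finite_words[OF assms(1)] by (auto simp: tensors_def)
  finally show "t v = (\<Sum>w\<in>words B n. t w \<cdot>\<^sub>T unit_tensor w) v" ..
qed

text \<open>Homogeneity of \<open>x\<close> kills every split position except m, and for a word of
  the wrong length the remainder is one on which \<open>y\<close> vanishes.\<close>

lemma tprod_apply:
  assumes x: "x \<in> tensors B m" and y: "y \<in> tensors B n"
  shows "(x \<otimes>\<^sub>T y) w = (if length w = m + n then x (take m w) * y (drop m w) else 0)"
proof -
  have "(x \<otimes>\<^sub>T y) w = (\<Sum>i\<le>length w. if i = m then x (take m w) * y (drop m w) else 0)"
    unfolding tprod_def
  proof (rule sum.cong)
    fix i assume "i \<in> {..length w}"
    then have "x (take i w) = 0" if "i \<noteq> m"
      using x that by (auto simp: tensors_def words_def)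
    then show "x (take i w) * y (drop i w) = (if i = m then x (take m w) * y (drop m w) else 0)"
      by simp
  qed simp
  also have "\<dots> = (if m \<le> length w then x (take m w) * y (drop m w) else 0)"
    by simp
  also have "\<dots> = (if length w = m + n then x (take m w) * y (drop m w) else 0)"
  proof -
    have "y (drop m w) = 0" if "m \<le> length w" "length w \<noteq> m + n"
    proof -
      have "drop m w \<notin> words B n"
        using that by (auto simp: words_def)
      then show ?thesis
        using y by (simp add: tensors_def)
    qed
    then show ?thesis
      by simp
  qed
  finally show ?thesis .
qed

lemma tprod_append:
  assumes "x \<in> tensors B m" "y \<in> tensors B n" "length u = m" "length v = n"
  shows "(x \<otimes>\<^sub>T y) (u @ v) = x u * y v"
  using assms by (simp add: tprod_apply)

lemma tprod_mem:
  assumes "x \<in> tensors B m" and "y \<in> tensors B n"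
  shows "x \<otimes>\<^sub>T y \<in> tensors B (m + n)"
proof -
  have "w \<in> words B (m + n)" if "length w = m + n" "x (take m w) * y (drop m w) \<noteq> 0" for w
  proof -
    have "take m w \<in> words B m" "drop m w \<in> words B n"
      using that tensors_eqD assms by (metis mult_eq_0_iff)+
    then have "take m w @ drop m w \<in> words B (m + n)"
      using that by (subst words_append) auto
    then show ?thesis
      by simp
  qed
  then show ?thesis
    using tprod_apply[OF assms] by (auto simp: tensors_def)
qed

lemma tprod_scale_left: "(c \<cdot>\<^sub>T x) \<otimes>\<^sub>T y = c \<cdot>\<^sub>T (x \<otimes>\<^sub>T y)"
  by (simp add: tprod_def tscale_def fun_eq_iff sum_distrib_left mult_ac)

lemma tprod_scale_right: "x \<otimes>\<^sub>T (c \<cdot>\<^sub>T y) = c \<cdot>\<^sub>T (x \<otimes>\<^sub>T y)"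
  by (simp add: tprod_def tscale_def fun_eq_iff sum_distrib_left mult_ac)

lemma tprod_zero [simp]: "0 \<otimes>\<^sub>T y = 0" "x \<otimes>\<^sub>T 0 = 0"
  by (simp_all add: tprod_def fun_eq_iff)

lemma tprod_sum_left: "(\<Sum>i\<in>A. f i) \<otimes>\<^sub>T y = (\<Sum>i\<in>A. f i \<otimes>\<^sub>T y)"
proof
  fix w
  have "((\<Sum>i\<in>A. f i) \<otimes>\<^sub>T y) w = (\<Sum>k\<le>length w. \<Sum>i\<in>A. f i (take k w) * y (drop k w))"
    by (simp add: tprod_def sum_fun_apply sum_distrib_right)
  also have "\<dots> = (\<Sum>i\<in>A. f i \<otimes>\<^sub>T y) w"
    by (subst sum.swap) (simp add: tprod_def sum_fun_apply)
  finally show "((\<Sum>i\<in>A. f i) \<otimes>\<^sub>T y) w = (\<Sum>i\<in>A. f i \<otimes>\<^sub>T y) w" .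
qed

lemma tprod_sum_right: "x \<otimes>\<^sub>T (\<Sum>i\<in>A. f i) = (\<Sum>i\<in>A. x \<otimes>\<^sub>T f i)"
proof
  fix w
  have "(x \<otimes>\<^sub>T (\<Sum>i\<in>A. f i)) w = (\<Sum>k\<le>length w. \<Sum>i\<in>A. x (take k w) * f i (drop k w))"
    by (simp add: tprod_def sum_fun_apply sum_distrib_left)
  also have "\<dots> = (\<Sum>i\<in>A. x \<otimes>\<^sub>T f i) w"
    by (subst sum.swap) (simp add: tprod_def sum_fun_apply)
  finally show "(x \<otimes>\<^sub>T (\<Sum>i\<in>A. f i)) w = (\<Sum>i\<in>A. x \<otimes>\<^sub>T f i) w" .
qed

lemma tprod_assoc:
  assumes "x \<in> tensors B l" "y \<in> tensors B m" "z \<in> tensors B n"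
  shows "(x \<otimes>\<^sub>T y) \<otimes>\<^sub>T z = x \<otimes>\<^sub>T (y \<otimes>\<^sub>T z)"
proof (rule ext)
  fix w
  have *: "x \<otimes>\<^sub>T y \<in> tensors B (l + m)" "y \<otimes>\<^sub>T z \<in> tensors B (m + n)"
    using assms tprod_mem by blast+
  show "((x \<otimes>\<^sub>T y) \<otimes>\<^sub>T z) w = (x \<otimes>\<^sub>T (y \<otimes>\<^sub>T z)) w"
    by (auto simp: tprod_apply[OF *(1) assms(3)] tprod_apply[OF assms(1) *(2)]
        tprod_apply[OF assms(1,2)] tprod_apply[OF assms(2,3)] take_drop add_ac)
qed

lemma unit_tensor_append:
  "unit_tensor (u @ v) = unit_tensor u \<otimes>\<^sub>T unit_tensor v"
proof -
  have u: "unit_tensor u \<in> tensors UNIV (length u)" and v: "unit_tensor v \<in> tensors UNIV (length v)"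
    by (auto simp: words_def intro!: unit_tensor_mem)
  show ?thesis
    proof
    fix w
    show "unit_tensor (u @ v) w = (unit_tensor u \<otimes>\<^sub>T unit_tensor v) w"
    proof (cases "w = u @ v")
      case False
      then have "take (length u) w \<noteq> u \<or> drop (length u) w \<noteq> v"
        by (metis append_take_drop_id)
      then show ?thesis
        using False unfolding tprod_apply[OF u v] unfolding unit_tensor_def by force
    qed (simp add: tprod_apply[OF u v], simp add: unit_tensor_def)
  qed
qed

text \<open>Linearity is relative to one tensor power because a braiding is constrained only on
  \<open>tensors B 2\<close>; elsewhere \<sigma> may be any function.\<close>

definition linear_on :: "'v set \<Rightarrow> nat \<Rightarrow> (('v, complex) tensor \<Rightarrow> ('v, complex) tensor) \<Rightarrow> bool" where
  "linear_on B n f \<longleftrightarrow> f \<in> tensors B n \<rightarrow> tensors B n \<and>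
     (\<forall>x\<in>tensors B n. \<forall>y\<in>tensors B n. f (x + y) = f x + f y) \<and>
     (\<forall>c. \<forall>x\<in>tensors B n. f (c \<cdot>\<^sub>T x) = c \<cdot>\<^sub>T f x)"

lemma linear_on_mem: "linear_on B n f \<Longrightarrow> x \<in> tensors B n \<Longrightarrow> f x \<in> tensors B n"
  and linear_on_add: "linear_on B n f \<Longrightarrow> x \<in> tensors B n \<Longrightarrow> y \<in> tensors B n \<Longrightarrow> f (x + y) = f x + f y"
  and linear_on_scale: "linear_on B n f \<Longrightarrow> x \<in> tensors B n \<Longrightarrow> f (c \<cdot>\<^sub>T x) = c \<cdot>\<^sub>T f x"
  by (auto simp: linear_on_def)

lemma tscale_0 [simp]: "0 \<cdot>\<^sub>T x = 0"
  by (auto simp: tscale_def)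

lemma linear_on_zero: "linear_on B n f \<Longrightarrow> f 0 = 0"
  using linear_on_scale[of B n f 0 0] by (simp add: tensors_zero)

lemma linear_on_sum:
  assumes f: "linear_on B n f" and g: "\<And>i. i \<in> A \<Longrightarrow> g i \<in> tensors B n"
  shows "f (\<Sum>i\<in>A. g i) = (\<Sum>i\<in>A. f (g i))"
proof -
  have "(\<forall>i\<in>A. g i \<in> tensors B n) \<longrightarrow> f (\<Sum>i\<in>A. g i) = (\<Sum>i\<in>A. f (g i))"
  proof (induction A rule: infinite_finite_induct)
    case (insert a A)
    have "f (g a + (\<Sum>i\<in>A. g i)) = f (g a) + f (\<Sum>i\<in>A. g i)" if "\<forall>i\<in>insert a A. g i \<in> tensors B n"
      using that by (intro linear_on_add[OF f] tensors_sum) auto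
    then show ?case
      unfolding sum.insert[OF insert.hyps] using insert.IH by (simp del: plus_fun_apply)
  qed (simp_all add: linear_on_zero[OF f] del: zero_fun_apply)
  then show ?thesis
    using g by blast
qed

lemma linear_on_id: "linear_on B n id"
  by (auto simp: linear_on_def)

lemma linear_on_comp: "linear_on B n f \<Longrightarrow> linear_on B n g \<Longrightarrow> linear_on B n (f \<circ> g)"
  by (auto simp: linear_on_def Pi_iff)

lemma linear_on_lincomb:
  fixes B :: "'v set"
  assumes "\<And>i. i \<in> A \<Longrightarrow> linear_on B n (f i)"
  shows "linear_on B n (\<lambda>x. \<Sum>i\<in>A. c i \<cdot>\<^sub>T f i x)"
  unfolding linear_on_def
proof (intro conjI ballI allI Pi_I)
  fix x :: "('v, complex) tensor" assume x: "x \<in> tensors B n"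
  show "(\<Sum>i\<in>A. c i \<cdot>\<^sub>T f i x) \<in> tensors B n"
    using assms x by (auto intro!: tensors_sum tensors_scale intro: linear_on_mem)
  show "(\<Sum>i\<in>A. c i \<cdot>\<^sub>T f i (d \<cdot>\<^sub>T x)) = d \<cdot>\<^sub>T (\<Sum>i\<in>A. c i \<cdot>\<^sub>T f i x)" for d
    using assms x by (auto simp: linear_on_scale[OF _ x] tensor.scale_sum_right mult.commute intro!: sum.cong)
  fix y :: "('v, complex) tensor" assume y: "y \<in> tensors B n"
  show "(\<Sum>i\<in>A. c i \<cdot>\<^sub>T f i (x + y)) = (\<Sum>i\<in>A. c i \<cdot>\<^sub>T f i x) + (\<Sum>i\<in>A. c i \<cdot>\<^sub>T f i y)"
    using assms by (simp add: linear_on_add[OF _ x y] tensor.scale_right_distrib sum.distrib del: plus_fun_apply)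
qed

lemma linear_on_scaled: "linear_on B n f \<Longrightarrow> linear_on B n (\<lambda>x. c \<cdot>\<^sub>T f x)"
  using linear_on_lincomb[of "{()}" B n "\<lambda>_. f" "\<lambda>_. c"] by simp

text \<open>Cutting each basis word after m letters shows that the pure tensors span.\<close>

lemma linear_on_eqI:
  assumes fin: "finite B" and f: "linear_on B (m + n) f" and g: "linear_on B (m + n) g"
    and eq: "\<And>x y. x \<in> tensors B m \<Longrightarrow> y \<in> tensors B n \<Longrightarrow> f (x \<otimes>\<^sub>T y) = g (x \<otimes>\<^sub>T y)"
    and t: "t \<in> tensors B (m + n)"
  shows "f t = g t"
proof -
  have expand: "h t = (\<Sum>w\<in>words B (m + n). t w \<cdot>\<^sub>T h (unit_tensor w))" if h: "linear_on B (m + n) h" for h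
  proof -
    have "h t = h (\<Sum>w\<in>words B (m + n). t w \<cdot>\<^sub>T unit_tensor w)"
      using tensor_expansion[OF fin t] by simp
    also have "\<dots> = (\<Sum>w\<in>words B (m + n). t w \<cdot>\<^sub>T h (unit_tensor w))"
      by (simp add: linear_on_sum[OF h] linear_on_scale[OF h] tensors_scale unit_tensor_mem)
    finally show ?thesis .
  qed
  have "f (unit_tensor w) = g (unit_tensor w)" if "w \<in> words B (m + n)" for w
  proof -
    have "take m w @ drop m w \<in> words B (m + n)" "length (take m w) = m"
      using that by (auto simp: words_def)
    then have "take m w \<in> words B m" "drop m w \<in> words B n"
      using words_append by blast+
    then show ?thesis
      using eq unit_tensor_mem unit_tensor_append[of "take m w" "drop m w"] by force
  qed
  then show ?thesis
    by (simp add: expand[OF f] expand[OF g])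
qed

section \<open>Braid operators on adjacent factors\<close>

definition slice :: "'v list \<Rightarrow> 'v list \<Rightarrow> nat \<Rightarrow> ('v, complex) tensor \<Rightarrow> ('v, complex) tensor" where
  "slice p s k t = (\<lambda>u. if length u = k then t (p @ u @ s) else 0)"

lemma slice_mem: "t \<in> tensors B n \<Longrightarrow> slice p s k t \<in> tensors B k"
  by (auto simp: slice_def tensors_def words_def)

lemma slice_add: "slice p s k (x + y) = slice p s k x + slice p s k y"
  and slice_scale: "slice p s k (c \<cdot>\<^sub>T x) = c \<cdot>\<^sub>T slice p s k x"
  by (auto simp: slice_def tscale_def)

lemma braid_at_eq_slice:
  "braid_at \<sigma> i t w = \<sigma> (slice (take (i - 1) w) (drop (i + 1) w) 2 t) (take 2 (drop (i - 1) w))"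
  unfolding braid_at_def slice_def by simp

definition braid_word ::
  "(('v, complex) tensor \<Rightarrow> ('v, complex) tensor) \<Rightarrow> nat list \<Rightarrow> ('v, complex) tensor \<Rightarrow> ('v, complex) tensor" where
  "braid_word \<sigma> is = foldr (\<lambda>i f. braid_at \<sigma> i \<circ> f) is id"

lemma braid_word_Nil [simp]: "braid_word \<sigma> [] t = t"
  and braid_word_Cons [simp]: "braid_word \<sigma> (i # is) t = braid_at \<sigma> i (braid_word \<sigma> is t)"
  by (simp_all add: braid_word_def)

lemma braid_word_append: "braid_word \<sigma> (is @ js) t = braid_word \<sigma> is (braid_word \<sigma> js t)"
  by (induction "is") auto

locale braided_space =
  fixes B :: "'v set" and \<sigma> :: "('v, complex) tensor \<Rightarrow> ('v, complex) tensor"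
  assumes fin: "finite B" and braiding: "braiding B \<sigma>"
begin

lemma linear_\<sigma>: "linear_on B 2 \<sigma>"
  using braiding by (auto simp: braiding_def linear_on_def bij_betw_def)

lemma linear_braid_at:
  assumes i: "1 \<le> i" "i < n"
  shows "linear_on B n (braid_at \<sigma> i)"
  unfolding linear_on_def
proof (intro conjI ballI allI Pi_I)
  fix t :: "('v, complex) tensor" assume t: "t \<in> tensors B n"
  show "braid_at \<sigma> i t \<in> tensors B n"
    unfolding tensors_def
  proof (intro CollectI allI impI)
    fix w assume w: "w \<notin> words B n"
    let ?p = "take (i - 1) w" and ?s = "drop (i + 1) w" and ?u = "take 2 (drop (i - 1) w)"
    have "?u \<notin> words B 2 \<or> slice ?p ?s 2 t = 0"
    proof (rule disjCI)
      assume *: "slice ?p ?s 2 t \<noteq> 0"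
      then obtain u where u: "length u = 2" "t (?p @ u @ ?s) \<noteq> 0"
        by (auto simp: slice_def fun_eq_iff split: if_splits)
      then have mem: "?p @ u @ ?s \<in> words B n"
        using t tensors_eqD by blast
      show "?u \<notin> words B 2"
      proof
        assume "?u \<in> words B 2"
        then have "length w \<ge> i + 1" "set ?u \<subseteq> B"
          using i by (auto simp: words_def)
        moreover have "w = ?p @ ?u @ ?s"
        proof -
          have "?s = drop 2 (drop (i - 1) w)"
            using i by simp
          then show ?thesis
            by (metis append_take_drop_id)
        qed
        moreover from this have "set w = set ?p \<union> set ?u \<union> set ?s"
          by (metis set_append sup_assoc)
        ultimately have "w \<in> words B n"
          using mem u i unfolding words_def by auto
        then show False
          using w by simp
      qed
    qed
    then show "braid_at \<sigma> i t w = 0"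
      using linear_on_mem[OF linear_\<sigma> slice_mem[OF t]] linear_on_zero[OF linear_\<sigma>]
      by (auto simp: braid_at_eq_slice tensors_def)
  qed
  show "braid_at \<sigma> i (c \<cdot>\<^sub>T t) = c \<cdot>\<^sub>T braid_at \<sigma> i t" for c
    unfolding fun_eq_iff braid_at_eq_slice slice_scale linear_on_scale[OF linear_\<sigma> slice_mem[OF t]]
    by (simp add: tscale_def braid_at_eq_slice)
  fix t' :: "('v, complex) tensor" assume t': "t' \<in> tensors B n"
  show "braid_at \<sigma> i (t + t') = braid_at \<sigma> i t + braid_at \<sigma> i t'"
    using linear_on_add[OF linear_\<sigma> slice_mem[OF t] slice_mem[OF t']]
    by (auto simp: fun_eq_iff braid_at_eq_slice slice_add)
qed

text \<open>Freezing the outer letters \<open>p\<close> and \<open>s\<close> commutes with a braid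
  operator acting strictly between them, its index being counted from the end of \<open>p\<close>.
  This localizes identities between braid operators to the few factors that they touch.\<close>

lemma slice_braid_at:
  assumes t: "t \<in> tensors B n" and j: "1 \<le> j" "j < k" and n: "length p + k + length s = n"
  shows "slice p s k (braid_at \<sigma> (length p + j) t) = braid_at \<sigma> j (slice p s k t)"
proof (rule tensors_eqI)
  show "slice p s k (braid_at \<sigma> (length p + j) t) \<in> tensors B k"
    using j n by (intro slice_mem[of _ B n] linear_on_mem[OF linear_braid_at t]) auto
  show "braid_at \<sigma> j (slice p s k t) \<in> tensors B k"
    using j by (intro linear_on_mem[OF linear_braid_at] slice_mem[OF t])
  fix u assume "u \<in> words B k"
  then have u: "length u = k"
    by (simp add: words_def)
  have 1: "take (length p + j - 1) (p @ u @ s) = p @ take (j - 1) u"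
    using j u by simp
  have 2: "drop (length p + j + 1) (p @ u @ s) = drop (j + 1) u @ s"
    using j u by simp
  have 3: "take 2 (drop (length p + j - 1) (p @ u @ s)) = take 2 (drop (j - 1) u)"
    using j u by simp
  have 4: "slice (p @ take (j - 1) u) (drop (j + 1) u @ s) 2 t =
      slice (take (j - 1) u) (drop (j + 1) u) 2 (slice p s k t)"
    using j u by (auto simp: slice_def fun_eq_iff)
  have "slice p s k (braid_at \<sigma> (length p + j) t) u = braid_at \<sigma> (length p + j) t (p @ u @ s)"
    by (simp add: slice_def u)
  also have "\<dots> = braid_at \<sigma> j (slice p s k t) u"
    unfolding braid_at_eq_slice 1 2 3 4 ..
  finally show "slice p s k (braid_at \<sigma> (length p + j) t) u = braid_at \<sigma> j (slice p s k t) u" .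
qed

text \<open>For each word the letters at i, i + 1, i + 2 are singled out and all others frozen. On
  the resulting tensor of degree 3 the operators are \<open>braid_at \<sigma> 1\<close> and
  \<open>braid_at \<sigma> 2\<close>, for which the relation is assumed.\<close>

lemma braid_relation:
  assumes t: "t \<in> tensors B n" and i: "1 \<le> i" "i + 1 < n"
  shows "braid_at \<sigma> i (braid_at \<sigma> (i + 1) (braid_at \<sigma> i t)) =
    braid_at \<sigma> (i + 1) (braid_at \<sigma> i (braid_at \<sigma> (i + 1) t))"
    (is "?L = ?R")
proof (rule tensors_eqI)
  have mem: "braid_at \<sigma> i x \<in> tensors B n" "braid_at \<sigma> (i + 1) x \<in> tensors B n"
    if "x \<in> tensors B n" for x :: "('v, complex) tensor"
    using i that by (auto intro!: linear_on_mem[OF linear_braid_at])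
  show "?L \<in> tensors B n" "?R \<in> tensors B n"
    using mem t by blast+
  fix w assume "w \<in> words B n"
  then have w: "length w = n"
    by (simp add: words_def)
  define p u s where "p = take (i - 1) w" and "u = take 3 (drop (i - 1) w)" and "s = drop (i + 2) w"
  have "w = p @ u @ drop 3 (drop (i - 1) w)"
    unfolding p_def u_def by (metis append_take_drop_id)
  then have w_eq: "w = p @ u @ s"
    using i by (simp add: s_def)
  have len: "length p = i - 1" "length u = 3" "length p + 3 + length s = n"
    using w i by (auto simp: p_def u_def s_def)
  have ip: "length p + 1 = i" "length p + 2 = i + 1"
    using len i by auto
  have sl: "slice p s 3 (braid_at \<sigma> i x) = braid_at \<sigma> 1 (slice p s 3 x)"
      "slice p s 3 (braid_at \<sigma> (i + 1) x) = braid_at \<sigma> 2 (slice p s 3 x)"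
    if "x \<in> tensors B n" for x
    using slice_braid_at[OF that, of 1 3 p s] slice_braid_at[OF that, of 2 3 p s] len(3)
    unfolding ip by auto
  have "slice p s 3 ?L = slice p s 3 ?R"
    using braiding mem t slice_mem[OF t] by (simp add: sl del: One_nat_def add_Suc_right Nat.add_0_right add_0_right) (simp add: braiding_def)
  then have "slice p s 3 ?L u = slice p s 3 ?R u"
    by simp
  then show "?L w = ?R w"
    using len w_eq by (simp add: slice_def)
qed

text \<open>With the suffix \<open>s\<close> frozen, the tensor product becomes the multiple
  \<open>y s \<cdot>\<^sub>T x\<close> of \<open>x\<close>, so linearity moves the operator to the
  left factor.\<close>

lemma braid_at_tprod_left:
  assumes x: "x \<in> tensors B m" and y: "y \<in> tensors B n" and i: "1 \<le> i" "i < m"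
  shows "braid_at \<sigma> i (x \<otimes>\<^sub>T y) = braid_at \<sigma> i x \<otimes>\<^sub>T y"
proof (rule tensors_eqI)
  have x': "braid_at \<sigma> i x \<in> tensors B m"
    by (rule linear_on_mem[OF linear_braid_at x]) (use i in auto)
  show "braid_at \<sigma> i (x \<otimes>\<^sub>T y) \<in> tensors B (m + n)"
    by (rule linear_on_mem[OF linear_braid_at tprod_mem[OF x y]]) (use i in auto)
  show "braid_at \<sigma> i x \<otimes>\<^sub>T y \<in> tensors B (m + n)"
    using tprod_mem[OF x' y] .
  fix w assume "w \<in> words B (m + n)"
  then have w: "length w = m + n"
    by (simp add: words_def)
  define u s where "u = take m w" and "s = drop m w"
  have us: "w = u @ s" "length u = m" "length s = n"
    using w by (auto simp: u_def s_def)
  have "slice [] s m (x \<otimes>\<^sub>T y) = y s \<cdot>\<^sub>T x"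
    using us tprod_append[OF x y] x by (auto simp: slice_def tscale_def fun_eq_iff tensors_def words_def)
  then have "slice [] s m (braid_at \<sigma> i (x \<otimes>\<^sub>T y)) = y s \<cdot>\<^sub>T braid_at \<sigma> i x"
    using slice_braid_at[OF tprod_mem[OF x y] i, of "[]" s] us linear_on_scale[OF linear_braid_at x] i
    by simp
  then have "slice [] s m (braid_at \<sigma> i (x \<otimes>\<^sub>T y)) u = (y s \<cdot>\<^sub>T braid_at \<sigma> i x) u"
    by simp
  then show "braid_at \<sigma> i (x \<otimes>\<^sub>T y) w = (braid_at \<sigma> i x \<otimes>\<^sub>T y) w"
    using us tprod_append[OF x' y] by (simp add: slice_def tscale_def)
qed

lemma braid_at_tprod_right:
  assumes x: "x \<in> tensors B m" and y: "y \<in> tensors B n" and i: "1 \<le> i" "i < n"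
  shows "braid_at \<sigma> (m + i) (x \<otimes>\<^sub>T y) = x \<otimes>\<^sub>T braid_at \<sigma> i y"
proof (rule tensors_eqI)
  have y': "braid_at \<sigma> i y \<in> tensors B n"
    by (rule linear_on_mem[OF linear_braid_at y]) (use i in auto)
  show "braid_at \<sigma> (m + i) (x \<otimes>\<^sub>T y) \<in> tensors B (m + n)"
    by (rule linear_on_mem[OF linear_braid_at tprod_mem[OF x y]]) (use i in auto)
  show "x \<otimes>\<^sub>T braid_at \<sigma> i y \<in> tensors B (m + n)"
    using tprod_mem[OF x y'] .
  fix w assume "w \<in> words B (m + n)"
  then have w: "length w = m + n"
    by (simp add: words_def)
  define p u where "p = take m w" and "u = drop m w"
  have us: "w = p @ u" "length p = m" "length u = n"
    using w by (auto simp: u_def p_def)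
  have "slice p [] n (x \<otimes>\<^sub>T y) = x p \<cdot>\<^sub>T y"
    using us tprod_append[OF x y] y by (auto simp: slice_def tscale_def fun_eq_iff tensors_def words_def)
  then have "slice p [] n (braid_at \<sigma> (m + i) (x \<otimes>\<^sub>T y)) = x p \<cdot>\<^sub>T braid_at \<sigma> i y"
    using slice_braid_at[OF tprod_mem[OF x y] i, of p "[]"] us linear_on_scale[OF linear_braid_at y] i
    by simp
  then have "slice p [] n (braid_at \<sigma> (m + i) (x \<otimes>\<^sub>T y)) u = (x p \<cdot>\<^sub>T braid_at \<sigma> i y) u"
    by simp
  then show "braid_at \<sigma> (m + i) (x \<otimes>\<^sub>T y) w = (x \<otimes>\<^sub>T braid_at \<sigma> i y) w"
    using us tprod_append[OF x y'] by (simp add: slice_def tscale_def)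
qed

text \<open>The tensor power is cut after factor i + 1. The operator at i then acts on the left
  part, and the one at j on the right part with index j - (i + 1), which is at least 1.\<close>

lemma braid_at_commute:
  assumes t: "t \<in> tensors B n" and ij: "1 \<le> i" "i + 2 \<le> j" "j < n"
  shows "braid_at \<sigma> i (braid_at \<sigma> j t) = braid_at \<sigma> j (braid_at \<sigma> i t)"
proof -
  have lin: "linear_on B (i + 1 + (n - (i + 1))) (braid_at \<sigma> i)"
      "linear_on B (i + 1 + (n - (i + 1))) (braid_at \<sigma> j)"
    using ij by (auto intro!: linear_braid_at)
  have "(braid_at \<sigma> i \<circ> braid_at \<sigma> j) t = (braid_at \<sigma> j \<circ> braid_at \<sigma> i) t"
  proof (rule linear_on_eqI[OF fin linear_on_comp[OF lin] linear_on_comp[OF lin(2,1)]])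
    show "t \<in> tensors B (i + 1 + (n - (i + 1)))"
      using t ij by simp
    fix x y :: "('v, complex) tensor"
    assume x: "x \<in> tensors B (i + 1)" and y: "y \<in> tensors B (n - (i + 1))"
    have x': "braid_at \<sigma> i x \<in> tensors B (i + 1)"
      using ij by (intro linear_on_mem[OF linear_braid_at x]) auto
    have y': "braid_at \<sigma> (j - (i + 1)) y \<in> tensors B (n - (i + 1))"
      using ij by (intro linear_on_mem[OF linear_braid_at y]) auto
    have l: "braid_at \<sigma> i (x \<otimes>\<^sub>T z) = braid_at \<sigma> i x \<otimes>\<^sub>T z" if "z \<in> tensors B (n - (i + 1))" for z
      using braid_at_tprod_left[OF x that] ij by simp
    have r: "braid_at \<sigma> j (z \<otimes>\<^sub>T y) = z \<otimes>\<^sub>T braid_at \<sigma> (j - (i + 1)) y" if "z \<in> tensors B (i + 1)" for z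
      using braid_at_tprod_right[OF that y, of "j - (i + 1)"] ij by simp
    show "(braid_at \<sigma> i \<circ> braid_at \<sigma> j) (x \<otimes>\<^sub>T y) = (braid_at \<sigma> j \<circ> braid_at \<sigma> i) (x \<otimes>\<^sub>T y)"
      using l r x y x' y' by simp
  qed
  then show ?thesis by simp
qed

lemma linear_braid_word: "set is \<subseteq> {1..<n} \<Longrightarrow> linear_on B n (braid_word \<sigma> is)"
proof (induction "is")
  case (Cons i "is")
  then have "linear_on B n (braid_at \<sigma> i \<circ> braid_word \<sigma> is)"
    by (intro linear_on_comp linear_braid_at) auto
  moreover have "braid_word \<sigma> (i # is) = braid_at \<sigma> i \<circ> braid_word \<sigma> is"
    by (simp add: fun_eq_iff)
  ultimately show ?case
    by (simp only:)
qed (simp add: braid_word_def linear_on_id)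

lemma braid_word_mem: "set is \<subseteq> {1..<n} \<Longrightarrow> t \<in> tensors B n \<Longrightarrow> braid_word \<sigma> is t \<in> tensors B n"
  using linear_on_mem linear_braid_word by blast

lemma braid_word_tprod_left:
  assumes x: "x \<in> tensors B m" and y: "y \<in> tensors B n" and "set is \<subseteq> {1..<m}"
  shows "braid_word \<sigma> is (x \<otimes>\<^sub>T y) = braid_word \<sigma> is x \<otimes>\<^sub>T y"
  using assms(3) by (induction "is") (auto simp: braid_at_tprod_left[OF braid_word_mem[OF _ x] y])

lemma braid_word_tprod_right:
  assumes x: "x \<in> tensors B m" and y: "y \<in> tensors B n" and "set is \<subseteq> {1..<n}"
  shows "braid_word \<sigma> (map (\<lambda>i. i + m) is) (x \<otimes>\<^sub>T y) = x \<otimes>\<^sub>T braid_word \<sigma> is y"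
  using assms(3)
proof (induction "is")
  case (Cons i "is")
  then show ?case
    using braid_at_tprod_right[OF x braid_word_mem[OF _ y], of "is" i] by (simp add: add.commute)
qed simp

section \<open>Matsumoto's theorem and the operators of permutations\<close>

lemma reduced_expression_subset: "reduced_expression n w is \<Longrightarrow> set is \<subseteq> {1..<n}"
  by (simp add: reduced_expression_def expression_def)

text \<open>Matsumoto's theorem: two distinct left descents \<open>i\<close> and \<open>j\<close> of a permutation allow a reduced
  expression beginning with the longest element of the subgroup that \<open>s\<^sub>i\<close> and \<open>s\<^sub>j\<close> generate, and
  this is where the two given expressions meet.\<close>

lemma braid_word_reduced_unique:
  assumes "reduced_expression n w is" "reduced_expression n w js" "t \<in> tensors B n"
  shows "braid_word \<sigma> is t = braid_word \<sigma> js t"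
  using assms
proof (induction "length is" arbitrary: w "is" js t rule: less_induct)
  case less
  have len: "length is = length js"
    using less.prems by (simp add: reduced_expression_def)
  show ?case
  proof (cases "is")
    case Nil
    then show ?thesis using len by simp
  next
    case (Cons i is')
    then obtain j js' where js: "js = j # js'"
      using len by (cases js) auto
    note I = reduced_expression_ConsD[OF less.prems(1)[unfolded Cons]]
    note J = reduced_expression_ConsD[OF less.prems(2)[unfolded js]]
    have w: "w permutes {1..n}"
      using less.prems(1) expression_permutes by (auto simp: reduced_expression_def)
    have IH: "reduced_expression n v ks \<Longrightarrow> reduced_expression n v ls \<Longrightarrow> length ks < length is \<Longrightarrow>
        braid_word \<sigma> ks t = braid_word \<sigma> ls t" for v ks ls
      using less.hyps less.prems(3) by blast
    \<comment> \<open>By symmetry a < b may be assumed. The induction hypothesis trades each tail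
      for one that starts with the other generator, after which a single commutation or braid
      relation finishes.\<close>
    have meet: "braid_at \<sigma> a (braid_word \<sigma> as t) = braid_at \<sigma> b (braid_word \<sigma> bs t)"
      if ab: "a < b" and a: "a \<in> {1..<n}" "descent a w" "reduced_expression n (transpose a (Suc a) \<circ> w) as"
        and b: "b \<in> {1..<n}" "descent b w" "reduced_expression n (transpose b (Suc b) \<circ> w) bs"
        and l: "length as < length is" "length bs < length is" for a b as bs
    proof -
      let ?sa = "transpose a (Suc a)" and ?sb = "transpose b (Suc b)"
      have p: "?sa permutes {1..n}" "?sb permutes {1..n}"
        using a b transpose_permutes by blast+
      have pa: "?sa \<circ> w permutes {1..n}" and pb: "?sb \<circ> w permutes {1..n}"
        using permutes_compose[OF w] p by blast+
      have pba: "?sb \<circ> (?sa \<circ> w) permutes {1..n}" and pab: "?sa \<circ> (?sb \<circ> w) permutes {1..n}"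
        using permutes_compose[OF pa p(2)] permutes_compose[OF pb p(1)] by auto
      note inv = inv_transpose_comp[OF w] inv_transpose_comp[OF pa] inv_transpose_comp[OF pb]
      show ?thesis
      proof (cases "b = Suc a")
        case False
        have comm: "?sb \<circ> (?sa \<circ> w) = ?sa \<circ> (?sb \<circ> w)"
          using ab False by (auto simp: fun_eq_iff transpose_def)
        obtain ks where ks: "reduced_expression n (?sb \<circ> (?sa \<circ> w)) ks"
          using ex_reduced_expression[OF pba] by blast
        have da: "descent b (?sa \<circ> w)" "descent a (?sb \<circ> w)"
          using a b ab False by (auto simp: inv transpose_def)
        have "reduced_expression n (?sa \<circ> w) (b # ks)"
          using reduced_expression_ConsI[OF pa b(1) da(1) ks] .
        then have 1: "braid_word \<sigma> as t = braid_word \<sigma> (b # ks) t"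
          using IH a(3) l(1) by blast
        have "reduced_expression n (?sb \<circ> w) (a # ks)"
          using reduced_expression_ConsI[OF pb a(1) da(2)] ks comm by simp
        then have 2: "braid_word \<sigma> bs t = braid_word \<sigma> (a # ks) t"
          using IH b(3) l(2) by blast
        have "braid_word \<sigma> ks t \<in> tensors B n"
          using braid_word_mem[OF reduced_expression_subset[OF ks] less.prems(3)] .
        from braid_at_commute[OF this, of a b] show ?thesis
          using 1 2 a b ab False by simp
      next
        case True
        have br: "?sa \<circ> (?sb \<circ> (?sa \<circ> w)) = ?sb \<circ> (?sa \<circ> (?sb \<circ> w))"
          using True by (auto simp: fun_eq_iff transpose_def)
        have pp: "?sa \<circ> (?sb \<circ> (?sa \<circ> w)) permutes {1..n}"
          using permutes_compose[OF pba p(1)] .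
        obtain ks where ks: "reduced_expression n (?sa \<circ> (?sb \<circ> (?sa \<circ> w))) ks"
          using ex_reduced_expression[OF pp] by blast
        \<comment> \<open>The two descents of \<open>w\<close> say that \<open>inv w\<close>
          decreases along a, a + 1, a + 2, so each partially stripped permutation still has the
          descent needed next.\<close>
        have da: "descent b (?sa \<circ> w)" "descent a (?sb \<circ> (?sa \<circ> w))"
            "descent a (?sb \<circ> w)" "descent b (?sa \<circ> (?sb \<circ> w))"
          unfolding inv using a b True by (auto simp: transpose_def)
        have "reduced_expression n (?sa \<circ> w) (b # a # ks)"
          using reduced_expression_ConsI[OF pa b(1) da(1)] reduced_expression_ConsI[OF pba a(1) da(2) ks] by blast
        then have 1: "braid_word \<sigma> as t = braid_word \<sigma> (b # a # ks) t"
          using IH a(3) l(1) by blast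
        have "reduced_expression n (?sb \<circ> w) (a # b # ks)"
          using reduced_expression_ConsI[OF pb a(1) da(3)] reduced_expression_ConsI[OF pab b(1) da(4)] ks br by simp
        then have 2: "braid_word \<sigma> bs t = braid_word \<sigma> (a # b # ks) t"
          using IH b(3) l(2) by blast
        have "braid_word \<sigma> ks t \<in> tensors B n"
          using braid_word_mem[OF reduced_expression_subset[OF ks] less.prems(3)] .
        from braid_relation[OF this, of a] show ?thesis
          using 1 2 a b True by simp
      qed
    qed
    have l: "length is' < length is" "length js' < length is"
      using Cons js len by auto
    consider "i = j" | "i < j" | "j < i"
      by linarith
    then have "braid_at \<sigma> i (braid_word \<sigma> is' t) = braid_at \<sigma> j (braid_word \<sigma> js' t)"
    proof cases
      case 1
      then show ?thesis
        using IH I(3) J(3) l(1) by metis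
    next
      case 2
      then show ?thesis
        using meet[OF _ I J l] by simp
    next
      case 3
      then show ?thesis
        using meet[OF _ J I l(2,1)] by simp
    qed
    then show ?thesis
      using Cons js by simp
  qed
qed

text \<open>This disposes of the choice in \<open>braid_perm\<close>: on tensors of degree n any
  reduced expression may be used.\<close>

lemma braid_perm_eq:
  assumes "reduced_expression n w is" "t \<in> tensors B n"
  shows "braid_perm \<sigma> n w t = braid_word \<sigma> is t"
proof -
  have "reduced_expression n w (SOME is. reduced_expression n w is)"
    using assms(1) by (rule someI)
  from braid_word_reduced_unique[OF this assms] show ?thesis
    by (simp add: braid_perm_def braid_word_def)
qed

lemma linear_braid_perm:
  assumes "w permutes {1..n}"
  shows "linear_on B n (braid_perm \<sigma> n w)"
proof -
  have "reduced_expression n w (SOME is. reduced_expression n w is)"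
    using ex_reduced_expression[OF assms] by (rule someI_ex)
  then show ?thesis
    using linear_braid_word[OF reduced_expression_subset] by (simp add: braid_perm_def braid_word_def)
qed

text \<open>Lengths add, so reduced expressions of the two factors concatenate to a reduced one of
  the composite.\<close>

lemma braid_perm_comp:
  assumes v: "v permutes {1..n}" and w: "w permutes {1..n}"
    and add: "inv_num (v \<circ> w) = inv_num v + inv_num w" and t: "t \<in> tensors B n"
  shows "braid_perm \<sigma> n (v \<circ> w) t = braid_perm \<sigma> n v (braid_perm \<sigma> n w t)"
proof -
  obtain "is" js where "is": "reduced_expression n v is" and js: "reduced_expression n w js"
    using ex_reduced_expression v w by blast
  show ?thesis
    using braid_perm_eq[OF reduced_expression_append[OF "is" js add] t] braid_perm_eq[OF js t]
      braid_perm_eq[OF "is" linear_on_mem[OF linear_braid_perm[OF w] t]]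
    by (simp add: braid_word_append)
qed

text \<open>The Young element has a reduced expression made of letters below m, which touch only the
  left factor, and letters above m, which touch only the right one.\<close>

lemma braid_perm_young:
  assumes u: "u permutes {1..m}" and v: "v permutes {1..n}"
    and x: "x \<in> tensors B m" and y: "y \<in> tensors B n"
  shows "braid_perm \<sigma> (m + n) (u \<circ> shift_perm m v) (x \<otimes>\<^sub>T y) = braid_perm \<sigma> m u x \<otimes>\<^sub>T braid_perm \<sigma> n v y"
proof -
  obtain "is" js where "is": "reduced_expression m u is" and js: "reduced_expression n v js"
    using ex_reduced_expression u v by blast
  note sub = reduced_expression_subset[OF "is"] reduced_expression_subset[OF js]
  have "reduced_expression (m + n) (u \<circ> shift_perm m v) (is @ map (\<lambda>i. i + m) js)"
    using inv_num_young[OF u v] inv_num_shift_perm[OF v]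
    by (intro reduced_expression_append reduced_expression_mono[OF "is"] reduced_expression_shift_perm[OF js]) simp
  from braid_perm_eq[OF this tprod_mem[OF x y]]
  have "braid_perm \<sigma> (m + n) (u \<circ> shift_perm m v) (x \<otimes>\<^sub>T y) = braid_word \<sigma> is (x \<otimes>\<^sub>T braid_word \<sigma> js y)"
    using braid_word_tprod_right[OF x y sub(2)] by (simp add: braid_word_append)
  then show ?thesis
    using braid_word_tprod_left[OF x braid_word_mem[OF sub(2) y] sub(1)]
      braid_perm_eq[OF "is" x] braid_perm_eq[OF js y] by simp
qed

end

section \<open>Antisymmetrizers and exterior powers\<close>

text \<open>The two block permutations have disjoint supports and commute, so the inverse can be
  written in the same order of blocks.\<close>

lemma inv_young:
  assumes u: "u permutes {1..m}" and v: "v permutes {1..n}"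
  shows "inv (u \<circ> shift_perm m v) = inv u \<circ> shift_perm m (inv v)"
proof -
  let ?y = "u \<circ> shift_perm m v" and ?z = "inv u \<circ> shift_perm m (inv v)"
  have fix_u: "u x = x" "inv u x = x" if "x \<notin> {1..m}" for x
    using that permutes_not_in[OF u] permutes_not_in[OF permutes_inv[OF u]] by auto
  have pos: "0 < inv v x \<longleftrightarrow> 0 < x" for x
    using permutes_in_image[OF permutes_inv[OF v], of x] permutes_not_in[OF permutes_inv[OF v], of x] by auto
  have "?y (?z x) = x" for x
  proof (cases "x \<le> m")
    case True
    have "inv u x \<le> m"
      using True permutes_in_image[OF permutes_inv[OF u], of x] fix_u(2)[of x] by (cases "x \<in> {1..m}") auto
    then show ?thesis
      using True by (simp add: shift_perm_def permutes_inverses[OF u])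
  next
    case False
    define z where "z = inv v (x - m) + m"
    have z: "m < z"
      using pos[of "x - m"] False by (simp add: z_def)
    then show ?thesis
      using False fix_u[of z] fix_u[of x]
      by (auto simp: shift_perm_def permutes_inverses[OF v] simp flip: z_def) (auto simp: z_def permutes_inverses[OF v])
  qed
  then have "?y \<circ> ?z = id"
    by (auto simp: fun_eq_iff)
  then have "inv ?y \<circ> (?y \<circ> ?z) = inv ?y"
    by simp
  then show ?thesis
    using permutes_inv_o(2)[OF young_permutes[OF u v]] by (simp add: o_assoc)
qed

lemma sum_permutes_shuffle_young:
  fixes f :: "(nat \<Rightarrow> nat) \<Rightarrow> 'c::comm_monoid_add"
  shows "sum f {p. p permutes {1..m + n}} =
    (\<Sum>w\<in>shuffle_perms m n. \<Sum>(u, v)\<in>{u. u permutes {1..m}} \<times> {v. v permutes {1..n}}.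
       f (w \<circ> (u \<circ> shift_perm m v)))"
  using sum.reindex_bij_betw[OF bij_betw_shuffle_young, of f]
  by (simp add: sum.cartesian_product case_prod_unfold)

text \<open>The shuffle decomposition is applied to p^(-1). Replacing \<open>u\<close> and
  \<open>v\<close> by their inverses turns the inverse of shuffle times Young element into Young
  element times inverse shuffle.\<close>

lemma sum_permutes_young_shuffle:
  fixes f :: "(nat \<Rightarrow> nat) \<Rightarrow> 'c::comm_monoid_add"
  shows "sum f {p. p permutes {1..m + n}} =
    (\<Sum>w\<in>shuffle_perms m n. \<Sum>(u, v)\<in>{u. u permutes {1..m}} \<times> {v. v permutes {1..n}}.
       f ((u \<circ> shift_perm m v) \<circ> inv w))"
proof -
  have eq: "inv (w \<circ> (inv u \<circ> shift_perm m (inv v))) = (u \<circ> shift_perm m v) \<circ> inv w"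
    if "w \<in> shuffle_perms m n" "u permutes {1..m}" "v permutes {1..n}" for w u v
  proof -
    note y = young_permutes[OF permutes_inv permutes_inv, OF that(2,3)]
    have "inv (w \<circ> (inv u \<circ> shift_perm m (inv v))) = inv (inv u \<circ> shift_perm m (inv v)) \<circ> inv w"
      using that(1) y by (intro o_inv_distrib) (auto simp: shuffle_perms_def permutes_bij)
    also have "inv (inv u \<circ> shift_perm m (inv v)) = u \<circ> shift_perm m v"
      using inv_young[OF permutes_inv permutes_inv, OF that(2,3)] permutes_inv_inv that(2,3) by metis
    finally show ?thesis .
  qed
  have "sum f {p. p permutes {1..m + n}} = (\<Sum>p | p permutes {1..m + n}. f (inv p))"
    by (rule sum_permutations_inverse)
  also have "\<dots> = (\<Sum>w\<in>shuffle_perms m n. \<Sum>u | u permutes {1..m}. \<Sum>v | v permutes {1..n}.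
       f (inv (w \<circ> (u \<circ> shift_perm m v))))"
    by (simp only: sum_permutes_shuffle_young sum.cartesian_product)
  also have "\<dots> = (\<Sum>w\<in>shuffle_perms m n. \<Sum>u | u permutes {1..m}. \<Sum>v | v permutes {1..n}.
       f (inv (w \<circ> (inv u \<circ> shift_perm m (inv v)))))"
    by (subst sum_permutations_inverse, subst (2) sum_permutations_inverse) simp
  also have "\<dots> = (\<Sum>w\<in>shuffle_perms m n. \<Sum>u | u permutes {1..m}. \<Sum>v | v permutes {1..n}.
       f ((u \<circ> shift_perm m v) \<circ> inv w))"
    using eq by (intro sum.cong refl arg_cong[of _ _ f]) auto
  finally show ?thesis
    by (simp add: sum.cartesian_product)
qed

lemma component_eq: "x \<in> tensors B n \<Longrightarrow> component k x = (if k = n then x else 0)"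
  by (auto simp: component_def tensors_def words_def fun_eq_iff)

locale quantum_exterior = braided_space B \<sigma>
  for B :: "'v set" and \<sigma> :: "('v, complex) tensor \<Rightarrow> ('v, complex) tensor" +
  fixes q :: complex
  assumes q_nonzero: "q \<noteq> 0" and q_generic: "r \<ge> 1 \<Longrightarrow> (q powi (-2)) ^ r \<noteq> 1"
begin

abbreviation wt :: "(nat \<Rightarrow> nat) \<Rightarrow> complex" where
  "wt w \<equiv> (- q) powi (- int (inv_num w))"

abbreviation qf :: "nat \<Rightarrow> complex" where
  "qf n \<equiv> qfact (q powi (-2)) n"

lemma wt_mult: "(- q) powi (- int (a + b)) = (- q) powi (- int a) * (- q) powi (- int b)"
  using q_nonzero by (subst power_int_add[symmetric]) auto

text \<open>All numerators 1 - q^(-2i) are nonzero by genericity; the exponent 1 also covers the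
  denominator 1 - q^(-2).\<close>

lemma qf_nonzero [simp]: "qf n \<noteq> 0"
  using q_generic q_generic[of 1] by (auto simp: qfact_def qint_def)

lemma qantisym_eq:
  "qantisym \<sigma> q k = (\<lambda>t. (1 / qf k) \<cdot>\<^sub>T (\<Sum>w | w permutes {1..k}. wt w \<cdot>\<^sub>T braid_perm \<sigma> k w t))"
  unfolding qantisym_def
  by (intro ext arg_cong2[of _ _ _ _ tscale] sum.cong refl) (auto simp: perm_length_eq_inv_num)

lemma Sh_plus_eq:
  "Sh_plus \<sigma> q m n = (\<lambda>t. Sh_coeff q m n \<cdot>\<^sub>T
     (\<Sum>w\<in>shuffle_perms m n. wt w \<cdot>\<^sub>T braid_perm \<sigma> (m + n) w t))"
  unfolding Sh_plus_def
  by (intro ext arg_cong2[of _ _ _ _ tscale] sum.cong refl)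
    (auto simp: perm_length_eq_inv_num shuffle_perms_def)

lemma Sh_minus_eq:
  "Sh_minus \<sigma> q m n = (\<lambda>t. Sh_coeff q m n \<cdot>\<^sub>T
     (\<Sum>w\<in>shuffle_perms m n. wt w \<cdot>\<^sub>T braid_perm \<sigma> (m + n) (inv w) t))"
  unfolding Sh_minus_def
  by (intro ext arg_cong2[of _ _ _ _ tscale] sum.cong refl)
    (auto simp: perm_length_eq_inv_num shuffle_perms_def)

lemma linear_qantisym: "linear_on B k (qantisym \<sigma> q k)"
  unfolding qantisym_eq
  by (intro linear_on_scaled linear_on_lincomb linear_braid_perm) simp

lemma linear_Sh_plus: "linear_on B (m + n) (Sh_plus \<sigma> q m n)"
  unfolding Sh_plus_eq
  by (intro linear_on_scaled linear_on_lincomb linear_braid_perm) (simp add: shuffle_perms_def)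

lemma linear_Sh_minus: "linear_on B (m + n) (Sh_minus \<sigma> q m n)"
  unfolding Sh_minus_eq
  by (intro linear_on_scaled linear_on_lincomb linear_braid_perm permutes_inv) (simp add: shuffle_perms_def)

text \<open>The antisymmetrizer of the Young subgroup. On pure tensors it is A^m \<otimes> A^n, but
  as an operator on the whole power of degree m + n it calls for no choice of a
  decomposition.\<close>

definition young_antisym :: "nat \<Rightarrow> nat \<Rightarrow> ('v, complex) tensor \<Rightarrow> ('v, complex) tensor" where
  "young_antisym m n t = (1 / (qf m * qf n)) \<cdot>\<^sub>T
     (\<Sum>z\<in>{u. u permutes {1..m}} \<times> {v. v permutes {1..n}}.
        (wt (fst z) * wt (snd z)) \<cdot>\<^sub>T braid_perm \<sigma> (m + n) (fst z \<circ> shift_perm m (snd z)) t)"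

lemma linear_young_antisym: "linear_on B (m + n) (young_antisym m n)"
  unfolding young_antisym_def[abs_def]
  by (intro linear_on_scaled linear_on_lincomb linear_braid_perm young_permutes) auto

lemma young_antisym_tprod:
  assumes x: "x \<in> tensors B m" and y: "y \<in> tensors B n"
  shows "young_antisym m n (x \<otimes>\<^sub>T y) = qantisym \<sigma> q m x \<otimes>\<^sub>T qantisym \<sigma> q n y"
proof -
  have "qantisym \<sigma> q m x \<otimes>\<^sub>T qantisym \<sigma> q n y = (1 / (qf m * qf n)) \<cdot>\<^sub>T
     (\<Sum>u | u permutes {1..m}. \<Sum>v | v permutes {1..n}.
        (wt u * wt v) \<cdot>\<^sub>T (braid_perm \<sigma> m u x \<otimes>\<^sub>T braid_perm \<sigma> n v y))"
    unfolding qantisym_eq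
    by (simp add: tprod_scale_left tprod_scale_right tprod_sum_left tprod_sum_right
        tensor.scale_sum_right mult_ac) (subst sum.swap, simp add: mult.commute)
  also have "\<dots> = young_antisym m n (x \<otimes>\<^sub>T y)"
    unfolding young_antisym_def sum.cartesian_product
    by (intro arg_cong2[of _ _ _ _ tscale] sum.cong refl) (auto simp: braid_perm_young[OF _ _ x y])
  finally show ?thesis ..
qed

text \<open>Lengths add along p = w y, so weights and operators multiply. The constants agree
  because \<open>Sh_coeff q m n\<close> divided by \<open>qf m * qf n\<close> is
  \<open>1 / qf (m + n)\<close>.\<close>

lemma qantisym_shuffle_young:
  assumes t: "t \<in> tensors B (m + n)"
  shows "qantisym \<sigma> q (m + n) t = Sh_plus \<sigma> q m n (young_antisym m n t)"
proof -
  let ?Z = "{u. u permutes {1..m}} \<times> {v. v permutes {1..n}}"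
  have "qantisym \<sigma> q (m + n) t = (1 / qf (m + n)) \<cdot>\<^sub>T
     (\<Sum>w\<in>shuffle_perms m n. \<Sum>z\<in>?Z. (wt w * (wt (fst z) * wt (snd z))) \<cdot>\<^sub>T
        braid_perm \<sigma> (m + n) w (braid_perm \<sigma> (m + n) (fst z \<circ> shift_perm m (snd z)) t))"
    unfolding qantisym_eq sum_permutes_shuffle_young
  proof (intro arg_cong2[of _ _ _ _ tscale] sum.cong refl, clarsimp)
    fix w u v assume w: "w \<in> shuffle_perms m n" and u: "u permutes {Suc 0..m}" and v: "v permutes {Suc 0..n}"
    then have uv: "u permutes {1..m}" "v permutes {1..n}" and w': "w permutes {1..m + n}"
      by (auto simp: shuffle_perms_def)
    show "wt (w \<circ> (u \<circ> shift_perm m v)) \<cdot>\<^sub>T braid_perm \<sigma> (m + n) (w \<circ> (u \<circ> shift_perm m v)) t =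
      (wt w * (wt u * wt v)) \<cdot>\<^sub>T braid_perm \<sigma> (m + n) w (braid_perm \<sigma> (m + n) (u \<circ> shift_perm m v) t)"
      using braid_perm_comp[OF w' young_permutes[OF uv] _ t] inv_num_shuffle_young[OF w uv] inv_num_young[OF uv]
      by (simp only: wt_mult)
  qed
  also have "\<dots> = Sh_plus \<sigma> q m n (young_antisym m n t)"
  proof -
    have mem: "braid_perm \<sigma> (m + n) (fst z \<circ> shift_perm m (snd z)) t \<in> tensors B (m + n)" if "z \<in> ?Z" for z
      using that by (intro linear_on_mem[OF linear_braid_perm t] young_permutes) auto
    have "braid_perm \<sigma> (m + n) w (young_antisym m n t) = (1 / (qf m * qf n)) \<cdot>\<^sub>T
        (\<Sum>z\<in>?Z. (wt (fst z) * wt (snd z)) \<cdot>\<^sub>T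
          braid_perm \<sigma> (m + n) w (braid_perm \<sigma> (m + n) (fst z \<circ> shift_perm m (snd z)) t))"
      if "w \<in> shuffle_perms m n" for w
    proof -
      have lin: "linear_on B (m + n) (braid_perm \<sigma> (m + n) w)"
        using that by (intro linear_braid_perm) (simp add: shuffle_perms_def)
      show ?thesis
        unfolding young_antisym_def
        by (simp add: linear_on_scale[OF lin] linear_on_sum[OF lin] tensors_sum tensors_scale mem)
    qed
    then show ?thesis
      unfolding Sh_plus_eq Sh_coeff_def
      by (simp add: tensor.scale_sum_right field_simps cong: sum.cong)
  qed
  finally show ?thesis .
qed

lemma qantisym_young_shuffle:
  assumes t: "t \<in> tensors B (m + n)"
  shows "qantisym \<sigma> q (m + n) t = young_antisym m n (Sh_minus \<sigma> q m n t)"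
proof -
  let ?Z = "{u. u permutes {1..m}} \<times> {v. v permutes {1..n}}"
  have "qantisym \<sigma> q (m + n) t = (1 / qf (m + n)) \<cdot>\<^sub>T
     (\<Sum>w\<in>shuffle_perms m n. \<Sum>z\<in>?Z. (wt w * (wt (fst z) * wt (snd z))) \<cdot>\<^sub>T
        braid_perm \<sigma> (m + n) (fst z \<circ> shift_perm m (snd z)) (braid_perm \<sigma> (m + n) (inv w) t))"
    unfolding qantisym_eq sum_permutes_young_shuffle
  proof (intro arg_cong2[of _ _ _ _ tscale] sum.cong refl, clarsimp)
    fix w u v assume w: "w \<in> shuffle_perms m n" and u: "u permutes {Suc 0..m}" and v: "v permutes {Suc 0..n}"
    then have uv: "u permutes {1..m}" "v permutes {1..n}" and w': "w permutes {1..m + n}"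
      by (auto simp: shuffle_perms_def)
    let ?y = "u \<circ> shift_perm m v"
    have y: "?y permutes {1..m + n}"
      by (rule young_permutes[OF uv])
    \<comment> \<open>The factors stand in the wrong order for \<open>inv_num_shuffle_young\<close>;
      the inverse w y^(-1) is a shuffle times a Young element and has the same length.\<close>
    have "inv_num (?y \<circ> inv w) = inv_num (inv (?y \<circ> inv w))"
      using inv_num_inv[OF permutes_compose[OF permutes_inv[OF w'] y]] by simp
    also have "inv (?y \<circ> inv w) = w \<circ> inv ?y"
      using o_inv_distrib[OF permutes_bij[OF y] permutes_bij[OF permutes_inv[OF w']]]
        permutes_inv_inv[OF w'] by simp
    also have "\<dots> = w \<circ> (inv u \<circ> shift_perm m (inv v))"
      using inv_young[OF uv] by simp
    also have "inv_num \<dots> = inv_num w + (inv_num u + inv_num v)"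
      using inv_num_shuffle_young[OF w permutes_inv permutes_inv, OF uv]
        inv_num_inv[OF uv(1)] inv_num_inv[OF uv(2)] by simp
    finally have num: "inv_num (?y \<circ> inv w) = inv_num w + (inv_num u + inv_num v)" .
    have "inv_num (?y \<circ> inv w) = inv_num ?y + inv_num (inv w)"
      using num inv_num_young[OF uv] inv_num_inv[OF w'] by simp
    from braid_perm_comp[OF y permutes_inv[OF w'] this t]
    show "wt (?y \<circ> inv w) \<cdot>\<^sub>T braid_perm \<sigma> (m + n) (?y \<circ> inv w) t =
      (wt w * (wt u * wt v)) \<cdot>\<^sub>T braid_perm \<sigma> (m + n) ?y (braid_perm \<sigma> (m + n) (inv w) t)"
      by (simp only: num wt_mult)
  qed
  also have "\<dots> = (1 / qf (m + n)) \<cdot>\<^sub>T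
     (\<Sum>z\<in>?Z. \<Sum>w\<in>shuffle_perms m n. (wt w * (wt (fst z) * wt (snd z))) \<cdot>\<^sub>T
        braid_perm \<sigma> (m + n) (fst z \<circ> shift_perm m (snd z)) (braid_perm \<sigma> (m + n) (inv w) t))"
    by (subst sum.swap) (rule refl)
  also have "\<dots> = young_antisym m n (Sh_minus \<sigma> q m n t)"
  proof -
    have mem: "braid_perm \<sigma> (m + n) (inv w) t \<in> tensors B (m + n)" if "w \<in> shuffle_perms m n" for w
      using that by (intro linear_on_mem[OF linear_braid_perm t] permutes_inv) (auto simp: shuffle_perms_def)
    have "braid_perm \<sigma> (m + n) (fst z \<circ> shift_perm m (snd z)) (Sh_minus \<sigma> q m n t) = Sh_coeff q m n \<cdot>\<^sub>T
        (\<Sum>w\<in>shuffle_perms m n. wt w \<cdot>\<^sub>T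
          braid_perm \<sigma> (m + n) (fst z \<circ> shift_perm m (snd z)) (braid_perm \<sigma> (m + n) (inv w) t))"
      if "z \<in> ?Z" for z
    proof -
      have lin: "linear_on B (m + n) (braid_perm \<sigma> (m + n) (fst z \<circ> shift_perm m (snd z)))"
        using that by (intro linear_braid_perm young_permutes) auto
      show ?thesis
        unfolding Sh_minus_eq
        by (simp add: linear_on_scale[OF lin] linear_on_sum[OF lin] tensors_sum tensors_scale mem)
    qed
    then show ?thesis
      unfolding young_antisym_def Sh_coeff_def
      by (simp add: tensor.scale_sum_right field_simps cong: sum.cong)
  qed
  finally show ?thesis .
qed

section \<open>The shuffle product and the exterior powers as images\<close>

lemma shuffle_prod_eq_Sh_plus:
  assumes x: "x \<in> tensors B m" and y: "y \<in> tensors B n"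
  shows "shuffle_prod \<sigma> q x y = Sh_plus \<sigma> q m n (x \<otimes>\<^sub>T y)"
proof
  fix w
  have zero: "Sh_plus \<sigma> q k l 0 = 0" for k l
    using linear_on_zero[OF linear_Sh_plus] .
  have "shuffle_prod \<sigma> q x y w =
      (\<Sum>k\<le>length w. if k = m then Sh_plus \<sigma> q m (length w - m) (x \<otimes>\<^sub>T component (length w - m) y) w else 0)"
    unfolding shuffle_prod_def by (intro sum.cong refl) (auto simp: component_eq[OF x] zero)
  also have "\<dots> = (if m \<le> length w then Sh_plus \<sigma> q m (length w - m) (x \<otimes>\<^sub>T component (length w - m) y) w else 0)"
    by simp
  also have "\<dots> = Sh_plus \<sigma> q m n (x \<otimes>\<^sub>T y) w"
  proof (cases "length w = m + n")
    case False
    then have "w \<notin> words B (m + n)"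
      by (simp add: words_def)
    then have "Sh_plus \<sigma> q m n (x \<otimes>\<^sub>T y) w = 0"
      using linear_on_mem[OF linear_Sh_plus tprod_mem[OF x y]] by (simp add: tensors_def)
    moreover have "component (length w - m) y = 0" if "m \<le> length w"
      using False that by (auto simp: component_eq[OF y])
    ultimately show ?thesis
      using zero by simp
  qed (simp add: component_eq[OF y])
  finally show "shuffle_prod \<sigma> q x y w = Sh_plus \<sigma> q m n (x \<otimes>\<^sub>T y) w" .
qed

lemma shuffle_prod_mem:
  assumes "x \<in> tensors B m" and "y \<in> tensors B n"
  shows "shuffle_prod \<sigma> q x y \<in> tensors B (m + n)"
  using shuffle_prod_eq_Sh_plus[OF assms] linear_on_mem[OF linear_Sh_plus tprod_mem[OF assms]] by simp

text \<open>The left side is Sh^+ of the Young antisymmetrizer of x \<otimes> y. On antisymmetrized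
  tensors, questions about the shuffle product thus become questions about concatenation.\<close>

lemma shuffle_prod_qantisym:
  assumes x: "x \<in> tensors B m" and y: "y \<in> tensors B n"
  shows "shuffle_prod \<sigma> q (qantisym \<sigma> q m x) (qantisym \<sigma> q n y) = qantisym \<sigma> q (m + n) (x \<otimes>\<^sub>T y)"
  using shuffle_prod_eq_Sh_plus linear_on_mem[OF linear_qantisym] x y
    qantisym_shuffle_young[OF tprod_mem[OF x y]] young_antisym_tprod[OF x y] by simp

lemma qantisym_trivial:
  assumes "k \<le> 1" "t \<in> tensors B k"
  shows "qantisym \<sigma> q k t = t"
proof -
  have perms: "{w. w permutes {1..k}} = {id}"
    using assms(1) by (cases k) auto
  have "reduced_expression k id []"
    by (simp add: reduced_expression_iff)
  from braid_perm_eq[OF this assms(2)] have "braid_perm \<sigma> k id t = t"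
    by simp
  moreover have "qf k = 1"
    using assms(1) q_generic[of 1] by (cases k) (auto simp: qfact_def qint_def)
  ultimately show ?thesis
    unfolding qantisym_eq perms by simp
qed

lemma component_shuffle_prod:
  "component k (shuffle_prod \<sigma> q x y) =
    (\<Sum>m\<le>k. component k (Sh_plus \<sigma> q m (k - m) (component m x \<otimes>\<^sub>T component (k - m) y)))"
  by (auto simp: component_def shuffle_prod_def sum_fun_apply fun_eq_iff)

text \<open>Elements of the generated algebra need not be homogeneous, so the induction carries all
  degrees at once; a component of a product is a sum over the splittings of its degree.\<close>

lemma component_qext_algebra:
  assumes "x \<in> qext_algebra B \<sigma> q"
  shows "component k x \<in> qantisym \<sigma> q k ` tensors B k"
  using assms
proof (induction arbitrary: k)
  have zero: "0 \<in> qantisym \<sigma> q k ` tensors B k" for k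
    using linear_on_zero[OF linear_qantisym] tensors_zero by (metis imageI)
  have image_add: "x + y \<in> qantisym \<sigma> q k ` tensors B k"
    if xy: "x \<in> qantisym \<sigma> q k ` tensors B k" "y \<in> qantisym \<sigma> q k ` tensors B k" for x y k
  proof -
    obtain a b where "a \<in> tensors B k" "b \<in> tensors B k" "x = qantisym \<sigma> q k a" "y = qantisym \<sigma> q k b"
      using xy by blast
    then show ?thesis
      using linear_on_add[OF linear_qantisym, of a k b] tensors_add by (metis imageI)
  qed
  {
    case one
    have "unit_tensor [] \<in> tensors B 0"
      by (auto simp: words_def intro!: unit_tensor_mem)
    then show ?case
      using qantisym_trivial[of 0] zero component_eq by (metis imageI le0)
  next
    case (gen x)
    then show ?case
      using qantisym_trivial[of 1] zero component_eq by (metis imageI le_refl)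
  next
    case (add x y)
    have "component k (x + y) = component k x + component k y"
      by (auto simp: component_def)
    then show ?case
      using add.IH image_add by (simp only:)
  next
    case (scale x c)
    have "component k (c \<cdot>\<^sub>T x) = c \<cdot>\<^sub>T component k x"
      by (auto simp: component_def tscale_def)
    moreover obtain a where "a \<in> tensors B k" "component k x = qantisym \<sigma> q k a"
      using scale.IH by blast
    ultimately show ?case
      using linear_on_scale[OF linear_qantisym, of a k c] tensors_scale[of a B k c] by (metis imageI)
  next
    case (mult x y)
    have component_mem: "component k (Sh_plus \<sigma> q m (k - m) (component m x \<otimes>\<^sub>T component (k - m) y))
        \<in> qantisym \<sigma> q k ` tensors B k" if "m \<le> k" for m
    proof -
      obtain a b where a: "a \<in> tensors B m" "component m x = qantisym \<sigma> q m a"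
        and b: "b \<in> tensors B (k - m)" "component (k - m) y = qantisym \<sigma> q (k - m) b"
        using mult.IH(1)[of m] mult.IH(2)[of "k - m"] by blast
      have "Sh_plus \<sigma> q m (k - m) (component m x \<otimes>\<^sub>T component (k - m) y) =
          qantisym \<sigma> q k (a \<otimes>\<^sub>T b)"
        using shuffle_prod_qantisym[OF a(1) b(1)] that a b
          shuffle_prod_eq_Sh_plus[OF linear_on_mem[OF linear_qantisym a(1)] linear_on_mem[OF linear_qantisym b(1)]]
        by simp
      moreover have "a \<otimes>\<^sub>T b \<in> tensors B k"
        using tprod_mem[OF a(1) b(1)] that by simp
      ultimately show ?thesis
        using component_eq[OF linear_on_mem[OF linear_qantisym]] by simp
    qed
    have image_sum: "sum f A \<in> qantisym \<sigma> q k ` tensors B k"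
      if "\<And>i. i \<in> A \<Longrightarrow> f i \<in> qantisym \<sigma> q k ` tensors B k" for f and A :: "nat set"
      using that by (induction A rule: infinite_finite_induct)
        (simp_all add: zero image_add
          del: plus_fun_apply zero_fun_apply)
    show ?case
      unfolding component_shuffle_prod using component_mem by (intro image_sum) simp
  }
qed

text \<open>An antisymmetrized word is the shuffle product of its letters: the last letter is split
  off, and on it the antisymmetrizer of degree 1 does nothing.\<close>

lemma qantisym_unit_tensor_mem:
  assumes "w \<in> words B k"
  shows "qantisym \<sigma> q k (unit_tensor w) \<in> qext_algebra B \<sigma> q"
  using assms
proof (induction w arbitrary: k rule: rev_induct)
  case Nil
  then have "k = 0"
    by (simp add: words_def)
  then show ?case
    using qantisym_trivial[OF _ unit_tensor_mem[OF Nil]] qext_algebra.one by simp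
next
  case (snoc b w)
  then obtain l where k: "k = l + 1"
    by (cases k) (auto simp: words_def)
  have wl: "w \<in> words B l" and b: "[b] \<in> words B 1"
    using snoc.prems k by (auto simp: words_def)
  have "qantisym \<sigma> q k (unit_tensor (w @ [b])) =
      shuffle_prod \<sigma> q (qantisym \<sigma> q l (unit_tensor w)) (unit_tensor [b])"
    using shuffle_prod_qantisym[OF unit_tensor_mem unit_tensor_mem, OF wl b]
      qantisym_trivial[OF _ unit_tensor_mem[OF b]] k by (simp add: unit_tensor_append)
  then show ?case
    using snoc.IH[OF wl] qext_algebra.gen[OF unit_tensor_mem[OF b]] by (simp add: qext_algebra.mult)
qed

lemma qext_eq_image: "qext B \<sigma> q k = qantisym \<sigma> q k ` tensors B k"
proof (intro equalityI subsetI)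
  fix x assume "x \<in> qext B \<sigma> q k"
  then show "x \<in> qantisym \<sigma> q k ` tensors B k"
    using component_qext_algebra[of x k] component_eq[of x B k k] by (simp add: qext_def)
next
  fix x assume "x \<in> qantisym \<sigma> q k ` tensors B k"
  then obtain t where t: "t \<in> tensors B k" "x = qantisym \<sigma> q k t"
    by blast
  have zero: "0 \<in> qext_algebra B \<sigma> q"
    using qext_algebra.scale[OF qext_algebra.one, where c = 0] by (simp only: tscale_0)
  have sum: "sum f A \<in> qext_algebra B \<sigma> q" if "\<forall>i\<in>A. f i \<in> qext_algebra B \<sigma> q" for f and A :: "'v list set"
    using that by (induction A rule: infinite_finite_induct)
      (simp_all add: zero qext_algebra.add del: plus_fun_apply zero_fun_apply)
  have "x = qantisym \<sigma> q k (\<Sum>w\<in>words B k. t w \<cdot>\<^sub>T unit_tensor w)"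
    using t tensor_expansion[OF fin t(1)] by simp
  also have "\<dots> = (\<Sum>w\<in>words B k. t w \<cdot>\<^sub>T qantisym \<sigma> q k (unit_tensor w))"
    by (simp add: linear_on_sum[OF linear_qantisym] linear_on_scale[OF linear_qantisym]
        tensors_scale unit_tensor_mem)
  also have "\<dots> \<in> qext_algebra B \<sigma> q"
    using qantisym_unit_tensor_mem qext_algebra.scale by (intro sum) blast
  finally show "x \<in> qext B \<sigma> q k"
    using t linear_on_mem[OF linear_qantisym] by (simp add: qext_def)
qed

end

section \<open>Convolution and minors\<close>

text \<open>\<open>tensor_lift\<close> sums over lists of pairs, so additivity on a set closed under
  sums has to be carried over to lists.\<close>

lemma additive_sum_list:
  assumes zero: "f 0 = 0" and add: "\<And>x y. x \<in> S \<Longrightarrow> y \<in> S \<Longrightarrow> f (x + y) = f x + f y"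
    and S: "0 \<in> S" "\<And>x y. x \<in> S \<Longrightarrow> y \<in> S \<Longrightarrow> x + y \<in> S" "set xs \<subseteq> S"
  shows "f (sum_list xs) = sum_list (map f xs) \<and> sum_list xs \<in> S"
  using S(3) by (induction xs) (simp_all add: zero add S del: zero_fun_apply plus_fun_apply)

context quantum_exterior
begin

lemma qext_subset: "qext B \<sigma> q k \<subseteq> tensors B k"
  by (auto simp: qext_def)

lemma qantisym_mem: "t \<in> tensors B k \<Longrightarrow> qantisym \<sigma> q k t \<in> qext B \<sigma> q k"
  by (simp add: qext_eq_image)

lemma shuffle_prod_qext:
  assumes "x \<in> qext B \<sigma> q m" "y \<in> qext B \<sigma> q n"
  shows "shuffle_prod \<sigma> q x y \<in> qext B \<sigma> q (m + n)"
  using assms by (auto simp: qext_def intro: shuffle_prod_mem qext_algebra.mult)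

text \<open>On exterior powers both bracketings are the antisymmetrizer of degree l + m + n applied
  to the same concatenation.\<close>

lemma shuffle_prod_assoc:
  assumes "x \<in> qext B \<sigma> q l" "y \<in> qext B \<sigma> q m" "z \<in> qext B \<sigma> q n"
  shows "shuffle_prod \<sigma> q (shuffle_prod \<sigma> q x y) z = shuffle_prod \<sigma> q x (shuffle_prod \<sigma> q y z)"
proof -
  obtain a b c where a: "a \<in> tensors B l" "x = qantisym \<sigma> q l a"
    and b: "b \<in> tensors B m" "y = qantisym \<sigma> q m b"
    and c: "c \<in> tensors B n" "z = qantisym \<sigma> q n c"
    using assms unfolding qext_eq_image by blast
  show ?thesis
    unfolding a b c shuffle_prod_qantisym[OF a(1) b(1)] shuffle_prod_qantisym[OF b(1) c(1)]
      shuffle_prod_qantisym[OF tprod_mem[OF a(1) b(1)] c(1)]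
      shuffle_prod_qantisym[OF a(1) tprod_mem[OF b(1) c(1)]]
    by (simp add: tprod_assoc[OF a(1) b(1) c(1)] add.assoc)
qed

section \<open>Decompositions into pure tensors and the coproduct\<close>

lemma ex_tprod_list:
  assumes t: "t \<in> tensors B (m + n)"
  obtains zs where "set zs \<subseteq> tensors B m \<times> tensors B n" "t = (\<Sum>(x, y)\<leftarrow>zs. x \<otimes>\<^sub>T y)"
proof -
  obtain ws where ws: "set ws = words B (m + n)" "distinct ws"
    using finite_distinct_list[OF finite_words[OF fin]] by blast
  define zs where "zs = map (\<lambda>w. (t w \<cdot>\<^sub>T unit_tensor (take m w), unit_tensor (drop m w))) ws"
  have "take m w \<in> words B m" "drop m w \<in> words B n" if "w \<in> words B (m + n)" for w
    using that by (auto simp: words_def dest: in_set_takeD in_set_dropD)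
  then have "set zs \<subseteq> tensors B m \<times> tensors B n"
    using ws by (auto simp: zs_def intro!: tensors_scale unit_tensor_mem)
  moreover have "(\<Sum>(x, y)\<leftarrow>zs. x \<otimes>\<^sub>T y) = (\<Sum>w\<leftarrow>ws. t w \<cdot>\<^sub>T unit_tensor w)"
    by (simp add: zs_def o_def tprod_scale_left flip: unit_tensor_append)
  then have "t = (\<Sum>(x, y)\<leftarrow>zs. x \<otimes>\<^sub>T y)"
    using tensor_expansion[OF fin t] ws by (simp add: sum_list_distinct_conv_sum_set)
  ultimately show thesis
    using that by blast
qed

lemma young_antisym_sum_list:
  assumes "set zs \<subseteq> tensors B m \<times> tensors B n"
  shows "young_antisym m n (\<Sum>(x, y)\<leftarrow>zs. x \<otimes>\<^sub>T y) =
    (\<Sum>(x, y)\<leftarrow>zs. qantisym \<sigma> q m x \<otimes>\<^sub>T qantisym \<sigma> q n y)"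
proof -
  let ?xs = "map (\<lambda>(x, y). x \<otimes>\<^sub>T y) zs"
  have "set ?xs \<subseteq> tensors B (m + n)"
    using assms tprod_mem by fastforce
  then have "young_antisym m n (sum_list ?xs) = sum_list (map (young_antisym m n) ?xs)"
    using additive_sum_list[of "young_antisym m n" "tensors B (m + n)" ?xs] linear_young_antisym
      linear_on_zero linear_on_add tensors_zero tensors_add by blast
  also have "map (young_antisym m n) ?xs = map (\<lambda>(x, y). qantisym \<sigma> q m x \<otimes>\<^sub>T qantisym \<sigma> q n y) zs"
    using assms young_antisym_tprod by auto
  finally show ?thesis .
qed

text \<open>Any decomposition of Sh^- t, once its entries are antisymmetrized, decomposes A^(m+n) t
  with entries in the smaller exterior powers. The choice inside \<open>conv\<close> is meaningful
  only because such a list exists.\<close>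

lemma ex_qext_tprod_list:
  assumes "x \<in> qext B \<sigma> q (m + n)"
  obtains zs where "set zs \<subseteq> qext B \<sigma> q m \<times> qext B \<sigma> q n" "x = (\<Sum>(y, z)\<leftarrow>zs. y \<otimes>\<^sub>T z)"
proof -
  obtain t where t: "t \<in> tensors B (m + n)" "x = qantisym \<sigma> q (m + n) t"
    using assms unfolding qext_eq_image by blast
  obtain zs where zs: "set zs \<subseteq> tensors B m \<times> tensors B n"
      "Sh_minus \<sigma> q m n t = (\<Sum>(y, z)\<leftarrow>zs. y \<otimes>\<^sub>T z)"
    using ex_tprod_list[OF linear_on_mem[OF linear_Sh_minus t(1)]] by blast
  define ys where "ys = map (\<lambda>(y, z). (qantisym \<sigma> q m y, qantisym \<sigma> q n z)) zs"
  have "set ys \<subseteq> qext B \<sigma> q m \<times> qext B \<sigma> q n"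
    using zs(1) qantisym_mem by (auto simp: ys_def)
  moreover have "x = (\<Sum>(y, z)\<leftarrow>ys. y \<otimes>\<^sub>T z)"
    unfolding t(2) qantisym_young_shuffle[OF t(1)] zs(2) young_antisym_sum_list[OF zs(1)]
    by (simp add: ys_def o_def case_prod_unfold)
  ultimately show thesis
    using that by blast
qed

text \<open>The choices of \<open>t\<close> and \<open>zs\<close> cancel: the value is always
  \<open>young_antisym m n\<close> of Sh^- t, which is A^(m+n) t and hence \<open>x\<close>.\<close>

lemma coprod_eq:
  assumes "x \<in> qext B \<sigma> q (m + n)"
  shows "coprod B \<sigma> q m n x = x"
proof -
  define t where "t = (SOME t. t \<in> tensors B (m + n) \<and> qantisym \<sigma> q (m + n) t = x)"
  have "\<exists>t. t \<in> tensors B (m + n) \<and> qantisym \<sigma> q (m + n) t = x"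
    using assms unfolding qext_eq_image by blast
  then have t: "t \<in> tensors B (m + n)" "qantisym \<sigma> q (m + n) t = x"
    unfolding t_def by (metis (mono_tags, lifting) someI_ex)+
  define zs where "zs = (SOME zs. set zs \<subseteq> tensors B m \<times> tensors B n \<and>
    Sh_minus \<sigma> q m n t = (\<Sum>(y, z)\<leftarrow>zs. y \<otimes>\<^sub>T z))"
  have "\<exists>zs. set zs \<subseteq> tensors B m \<times> tensors B n \<and> Sh_minus \<sigma> q m n t = (\<Sum>(y, z)\<leftarrow>zs. y \<otimes>\<^sub>T z)"
    using ex_tprod_list[OF linear_on_mem[OF linear_Sh_minus t(1)]] by metis
  then have zs: "set zs \<subseteq> tensors B m \<times> tensors B n"
      "Sh_minus \<sigma> q m n t = (\<Sum>(y, z)\<leftarrow>zs. y \<otimes>\<^sub>T z)"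
    unfolding zs_def by (metis (mono_tags, lifting) someI_ex)+
  have "coprod B \<sigma> q m n x = (\<Sum>(y, z)\<leftarrow>zs. qantisym \<sigma> q m y \<otimes>\<^sub>T qantisym \<sigma> q n z)"
    by (simp add: coprod_def tensor_lift_def Let_def flip: t_def zs_def)
  also have "\<dots> = young_antisym m n (Sh_minus \<sigma> q m n t)"
    unfolding zs(2) young_antisym_sum_list[OF zs(1)] ..
  also have "\<dots> = x"
    using qantisym_young_shuffle[OF t(1)] t(2) by simp
  finally show ?thesis .
qed

text \<open>The bilinear expansion over words is the form in which \<open>vprod\<close> is
  written.\<close>

lemma shuffle_prod_expansion:
  assumes x: "x \<in> tensors B m" and y: "y \<in> tensors B n"
  shows "shuffle_prod \<sigma> q x y = (\<Sum>u\<in>words B m. \<Sum>v\<in>words B n.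
    (x u * y v) \<cdot>\<^sub>T shuffle_prod \<sigma> q (unit_tensor u) (unit_tensor v))"
proof -
  have "x \<otimes>\<^sub>T y = (\<Sum>u\<in>words B m. x u \<cdot>\<^sub>T unit_tensor u) \<otimes>\<^sub>T (\<Sum>v\<in>words B n. y v \<cdot>\<^sub>T unit_tensor v)"
    using tensor_expansion[OF fin x] tensor_expansion[OF fin y] by simp
  also have "\<dots> = (\<Sum>u\<in>words B m. \<Sum>v\<in>words B n. (x u * y v) \<cdot>\<^sub>T (unit_tensor u \<otimes>\<^sub>T unit_tensor v))"
    by (simp add: tprod_sum_left tprod_sum_right tprod_scale_left tprod_scale_right tensor.scale_sum_right)
      (subst sum.swap, simp add: mult.commute)
  finally have xy: "x \<otimes>\<^sub>T y = \<dots>" .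
  have mem: "unit_tensor u \<otimes>\<^sub>T unit_tensor v \<in> tensors B (m + n)" if "u \<in> words B m" "v \<in> words B n" for u v
    using that by (intro tprod_mem unit_tensor_mem)
  show ?thesis
    unfolding shuffle_prod_eq_Sh_plus[OF x y] xy
    by (simp add: linear_on_sum[OF linear_Sh_plus] linear_on_scale[OF linear_Sh_plus]
        tensors_sum tensors_scale mem shuffle_prod_eq_Sh_plus[OF unit_tensor_mem unit_tensor_mem])
qed

end

section \<open>The product with coefficients in the algebra\<close>

locale quantum_convolution = quantum_exterior B \<sigma> q + complex_assoc_algebra sc
  for B :: "'v set" and \<sigma> :: "('v, complex) tensor \<Rightarrow> ('v, complex) tensor" and q :: complex
    and sc :: "complex \<Rightarrow> 'a::ring \<Rightarrow> 'a"
begin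

abbreviation vp :: "('v, 'a) tensor \<Rightarrow> ('v, 'a) tensor \<Rightarrow> ('v, 'a) tensor" (infixl "\<bullet>" 70) where
  "P \<bullet> Q \<equiv> vprod sc B \<sigma> q P Q"

lemma vprod_add_left: "(P + P') \<bullet> Q = P \<bullet> Q + P' \<bullet> Q"
  by (simp add: vprod_def fun_eq_iff algebra_simps scale_right_distrib sum.distrib)

lemma vprod_add_right: "P \<bullet> (Q + Q') = P \<bullet> Q + P \<bullet> Q'"
  by (simp add: vprod_def fun_eq_iff algebra_simps scale_right_distrib sum.distrib)

lemma vprod_zero: "0 \<bullet> Q = 0" "P \<bullet> 0 = 0"
  by (simp_all add: vprod_def fun_eq_iff)

lemma vprod_vscale_left: "vscale sc c P \<bullet> Q = vscale sc c (P \<bullet> Q)"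
  by (simp add: vprod_def vscale_def fun_eq_iff scale_sum_right scale_mult_left mult.commute)

lemma vprod_vscale_right: "P \<bullet> vscale sc c Q = vscale sc c (P \<bullet> Q)"
  by (simp add: vprod_def vscale_def fun_eq_iff scale_sum_right scale_mult_right mult.commute)

lemma vprod_sum_left: "(\<Sum>i\<in>A. P i) \<bullet> Q = (\<Sum>i\<in>A. P i \<bullet> Q)"
  by (induction A rule: infinite_finite_induct)
    (simp_all add: vprod_zero vprod_add_left del: zero_fun_apply plus_fun_apply)

lemma vprod_sum_right: "P \<bullet> (\<Sum>i\<in>A. Q i) = (\<Sum>i\<in>A. P \<bullet> Q i)"
  by (induction A rule: infinite_finite_induct)
    (simp_all add: vprod_zero vprod_add_right del: zero_fun_apply plus_fun_apply)

text \<open>Words \<open>u\<close> of length other than m contribute nothing, since \<open>x\<close>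
  vanishes on them; the rest is \<open>shuffle_prod_expansion\<close> evaluated at
  \<open>w\<close>.\<close>

lemma vprod_vtensor:
  assumes x: "x \<in> tensors B m" and y: "y \<in> tensors B n"
  shows "vtensor sc x a \<bullet> vtensor sc y b = vtensor sc (shuffle_prod \<sigma> q x y) (a * b)"
proof
  fix w
  let ?S = "\<lambda>k l. \<Sum>u\<in>words B k. \<Sum>v\<in>words B l.
    (x u * y v) * shuffle_prod \<sigma> q (unit_tensor u) (unit_tensor v) w"
  have "(vtensor sc x a \<bullet> vtensor sc y b) w = sc (\<Sum>k\<le>length w. ?S k (length w - k)) (a * b)"
    by (simp add: vprod_def vtensor_def scale_sum_left scale_mult_left scale_mult_right mult_ac)
  also have "(\<Sum>k\<le>length w. ?S k (length w - k)) = (\<Sum>k\<le>length w. if k = m then ?S m (length w - m) else 0)"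
  proof (intro sum.cong refl)
    fix k
    have "x u = 0" if "k \<noteq> m" "u \<in> words B k" for u
      using that x by (auto simp: tensors_def words_def)
    then show "?S k (length w - k) = (if k = m then ?S m (length w - m) else 0)"
      by auto
  qed
  also have "\<dots> = (if m \<le> length w then ?S m (length w - m) else 0)"
    by simp
  also have "\<dots> = shuffle_prod \<sigma> q x y w"
  proof (cases "length w = m + n")
    case True
    then show ?thesis
      by (subst shuffle_prod_expansion[OF x y]) (simp add: sum_fun_apply tscale_def)
  next
    case False
    then have "w \<notin> words B (m + n)"
      by (simp add: words_def)
    then have "shuffle_prod \<sigma> q x y w = 0"
      using shuffle_prod_mem[OF x y] by (simp add: tensors_def)
    moreover have "?S m (length w - m) = 0" if "m \<le> length w"
    proof -
      have "length w - m \<noteq> n"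
        using that False by simp
      then have "y v = 0" if "v \<in> words B (length w - m)" for v
        using that y by (auto simp: tensors_def words_def)
      then show ?thesis
        by simp
    qed
    ultimately show ?thesis
      by simp
  qed
  finally show "(vtensor sc x a \<bullet> vtensor sc y b) w = vtensor sc (shuffle_prod \<sigma> q x y) (a * b) w"
    by (simp add: vtensor_def)
qed

text \<open>The k-th exterior power tensored with the algebra, realized as finite sums of pure
  tensors. Adding one pure tensor at a time yields an induction rule that reduces multilinear
  identities to pure tensors.\<close>

inductive_set ext_values :: "nat \<Rightarrow> ('v, 'a) tensor set" for k where
  zero: "0 \<in> ext_values k"
| step: "x \<in> qext B \<sigma> q k \<Longrightarrow> P \<in> ext_values k \<Longrightarrow> vtensor sc x a + P \<in> ext_values k"

lemma ext_values_vtensor: "x \<in> qext B \<sigma> q k \<Longrightarrow> vtensor sc x a \<in> ext_values k"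
  using ext_values.step[OF _ ext_values.zero] by (simp del: zero_fun_apply plus_fun_apply)

lemma ext_values_add: "P \<in> ext_values k \<Longrightarrow> Q \<in> ext_values k \<Longrightarrow> P + Q \<in> ext_values k"
  by (induction rule: ext_values.induct)
    (simp_all add: ext_values.step add.assoc del: zero_fun_apply plus_fun_apply)

lemma ext_values_sum: "(\<And>i. i \<in> A \<Longrightarrow> P i \<in> ext_values k) \<Longrightarrow> sum P A \<in> ext_values k"
  by (induction A rule: infinite_finite_induct)
    (simp_all add: ext_values.zero ext_values_add del: zero_fun_apply plus_fun_apply)

lemma ext_values_vscale: "P \<in> ext_values k \<Longrightarrow> vscale sc c P \<in> ext_values k"
proof (induction rule: ext_values.induct)
  case zero
  have "vscale sc c 0 = (0 :: ('v, 'a) tensor)"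
    by (auto simp: vscale_def)
  then show ?case
    using ext_values.zero by (simp del: zero_fun_apply)
next
  case (step x P a)
  have "vscale sc c (vtensor sc x a + P) = vtensor sc x (sc c a) + vscale sc c P"
    by (auto simp: vscale_def vtensor_def scale_right_distrib mult.commute)
  then show ?case
    using ext_values.step step by (simp del: plus_fun_apply)
qed

lemma vprod_mem:
  assumes "P \<in> ext_values m" "Q \<in> ext_values n"
  shows "P \<bullet> Q \<in> ext_values (m + n)"
  using assms(1)
proof (induction rule: ext_values.induct)
  case (step x P a)
  have "vtensor sc x a \<bullet> Q \<in> ext_values (m + n)"
    using assms(2)
  proof (induction rule: ext_values.induct)
    case (step y Q b)
    then have "vtensor sc x a \<bullet> vtensor sc y b \<in> ext_values (m + n)"
      using vprod_vtensor[of x m y n a b] \<open>x \<in> qext B \<sigma> q m\<close> qext_subset shuffle_prod_qext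
        ext_values_vtensor by (metis subsetD)
    then show ?case
      using step by (simp add: vprod_add_right ext_values_add del: plus_fun_apply)
  qed (simp add: vprod_zero ext_values.zero del: zero_fun_apply)
  then show ?case
    using step by (simp add: vprod_add_left ext_values_add del: plus_fun_apply)
qed (simp add: vprod_zero ext_values.zero del: zero_fun_apply)

text \<open>Three nested inductions reach pure tensors, where the claim splits into associativity of
  the shuffle product on exterior powers and of the algebra.\<close>

lemma vprod_assoc:
  assumes P: "P \<in> ext_values l" and Q: "Q \<in> ext_values m" and R: "R \<in> ext_values n"
  shows "(P \<bullet> Q) \<bullet> R = P \<bullet> (Q \<bullet> R)"
  using P
proof (induction rule: ext_values.induct)
  case (step x P a)
  note x = step.hyps(1)
  have "(vtensor sc x a \<bullet> Q) \<bullet> R = vtensor sc x a \<bullet> (Q \<bullet> R)"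
    using Q
  proof (induction rule: ext_values.induct)
    case (step y Q b)
    note y = step.hyps(1)
    have "(vtensor sc x a \<bullet> vtensor sc y b) \<bullet> R = vtensor sc x a \<bullet> (vtensor sc y b \<bullet> R)"
      using R
    proof (induction rule: ext_values.induct)
      case (step z R c)
      note z = step.hyps(1)
      have mem: "x \<in> tensors B l" "y \<in> tensors B m" "z \<in> tensors B n"
        using x y z qext_subset by blast+
      have "(vtensor sc x a \<bullet> vtensor sc y b) \<bullet> vtensor sc z c =
          vtensor sc x a \<bullet> (vtensor sc y b \<bullet> vtensor sc z c)"
        using mem by (simp add: vprod_vtensor[OF mem(1,2)] vprod_vtensor[OF mem(2,3)]
            vprod_vtensor[OF mem(1) shuffle_prod_mem[OF mem(2,3)]]
            vprod_vtensor[OF shuffle_prod_mem[OF mem(1,2)] mem(3)]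
            shuffle_prod_assoc[OF x y z] mult.assoc)
      then show ?case
        using step.IH by (simp add: vprod_add_right del: plus_fun_apply)
    qed (simp add: vprod_zero del: zero_fun_apply)
    then show ?case
      using step.IH by (simp add: vprod_add_right vprod_add_left del: plus_fun_apply)
  qed (simp add: vprod_zero del: zero_fun_apply)
  then show ?case
    using step.IH by (simp add: vprod_add_left del: plus_fun_apply)
qed (simp add: vprod_zero del: zero_fun_apply)

section \<open>Convolution powers as products along words\<close>

definition extend :: "('v list \<Rightarrow> ('v, 'a) tensor) \<Rightarrow> nat \<Rightarrow> ('v, complex) tensor \<Rightarrow> ('v, 'a) tensor" where
  "extend g k t = (\<Sum>w\<in>words B k. vscale sc (t w) (g w))"

lemma vscale_add: "vscale sc (c + d) P = vscale sc c P + vscale sc d P"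
  by (auto simp: vscale_def scale_left_distrib)

lemma vscale_sum: "vscale sc c (\<Sum>i\<in>A. P i) = (\<Sum>i\<in>A. vscale sc c (P i))"
  by (simp add: vscale_def fun_eq_iff sum_fun_apply scale_sum_right)

lemma extend_add: "extend g k (s + t) = extend g k s + extend g k t"
  by (simp add: extend_def vscale_add sum.distrib)

lemma extend_scale: "extend g k (c \<cdot>\<^sub>T t) = vscale sc c (extend g k t)"
  by (simp add: extend_def vscale_def fun_eq_iff tscale_def sum_fun_apply scale_sum_right)

lemma extend_zero: "extend g k 0 = 0"
  by (simp add: extend_def vscale_def fun_eq_iff sum_fun_apply)

lemma extend_sum: "extend g k (\<Sum>i\<in>A. t i) = (\<Sum>i\<in>A. extend g k (t i))"
  by (induction A rule: infinite_finite_induct)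
    (simp_all add: extend_zero extend_add del: zero_fun_apply plus_fun_apply)

lemma vprod_extend:
  assumes y: "y \<in> tensors B m" and z: "z \<in> tensors B n"
    and gh: "\<And>u v. u \<in> words B m \<Longrightarrow> v \<in> words B n \<Longrightarrow> f (u @ v) = g u \<bullet> h v"
  shows "extend g m y \<bullet> extend h n z = extend f (m + n) (y \<otimes>\<^sub>T z)"
proof -
  have "extend g m y \<bullet> extend h n z =
      (\<Sum>u\<in>words B m. \<Sum>v\<in>words B n. vscale sc (y u) (vscale sc (z v) (g u \<bullet> h v)))"
    unfolding extend_def vprod_sum_left vprod_vscale_left
    by (simp add: vprod_sum_right vprod_vscale_right vscale_sum)
  also have "\<dots> = (\<Sum>u\<in>words B m. \<Sum>v\<in>words B n. vscale sc ((y \<otimes>\<^sub>T z) (u @ v)) (f (u @ v)))"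
  proof (intro sum.cong refl)
    fix u v assume u: "u \<in> words B m" and v: "v \<in> words B n"
    then have "(y \<otimes>\<^sub>T z) (u @ v) = y u * z v"
      by (intro tprod_append[OF y z]) (auto simp: words_def)
    then show "vscale sc (y u) (vscale sc (z v) (g u \<bullet> h v)) = vscale sc ((y \<otimes>\<^sub>T z) (u @ v)) (f (u @ v))"
      using gh[OF u v] by (simp add: vscale_def)
  qed
  finally show ?thesis
    by (simp add: extend_def sum_words_append)
qed

text \<open>Whichever decomposition \<open>zs\<close> is chosen, each pair in it contributes
  \<open>extend f (m + n)\<close> of y \<otimes> z. This map is additive and defined on the whole
  tensor power, so the sum depends on \<open>x\<close> alone.\<close>

lemma conv_eq_extend:
  assumes x: "x \<in> qext B \<sigma> q (m + n)"
    and P: "\<And>y. y \<in> qext B \<sigma> q m \<Longrightarrow> P y = extend g m y"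
    and Q: "\<And>z. z \<in> qext B \<sigma> q n \<Longrightarrow> Q z = extend h n z"
    and gh: "\<And>u v. u \<in> words B m \<Longrightarrow> v \<in> words B n \<Longrightarrow> f (u @ v) = g u \<bullet> h v"
  shows "conv sc B \<sigma> q m n P Q x = extend f (m + n) x"
proof -
  define zs where "zs = (SOME zs. set zs \<subseteq> qext B \<sigma> q m \<times> qext B \<sigma> q n \<and> x = (\<Sum>(y, z)\<leftarrow>zs. y \<otimes>\<^sub>T z))"
  have "\<exists>zs. set zs \<subseteq> qext B \<sigma> q m \<times> qext B \<sigma> q n \<and> x = (\<Sum>(y, z)\<leftarrow>zs. y \<otimes>\<^sub>T z)"
    using ex_qext_tprod_list[OF x] by metis
  then have zs: "set zs \<subseteq> qext B \<sigma> q m \<times> qext B \<sigma> q n" "x = (\<Sum>(y, z)\<leftarrow>zs. y \<otimes>\<^sub>T z)"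
    unfolding zs_def by (metis (mono_tags, lifting) someI_ex)+
  have "conv sc B \<sigma> q m n P Q x = (\<Sum>(y, z)\<leftarrow>zs. P y \<bullet> Q z)"
    by (simp add: conv_def coprod_eq[OF x] tensor_lift_def Let_def flip: zs_def)
  also have "\<dots> = sum_list (map (extend f (m + n)) (map (\<lambda>(y, z). y \<otimes>\<^sub>T z) zs))"
  proof -
    have "P y \<bullet> Q z = extend f (m + n) (y \<otimes>\<^sub>T z)" if "(y, z) \<in> set zs" for y z
    proof -
      have yz: "y \<in> qext B \<sigma> q m" "z \<in> qext B \<sigma> q n"
        using that zs(1) by blast+
      then have "y \<in> tensors B m" "z \<in> tensors B n"
        using qext_subset by blast+
      from vprod_extend[where f = f and g = g and h = h, OF this gh] show ?thesis
        using P Q yz by simp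
    qed
    then show ?thesis
      by (intro arg_cong[of _ _ sum_list]) auto
  qed
  also have "\<dots> = extend f (m + n) x"
    unfolding zs(2)
    using additive_sum_list[of "extend f (m + n)" UNIV "map (\<lambda>(y, z). y \<otimes>\<^sub>T z) zs"]
    by (simp add: extend_zero extend_add del: zero_fun_apply plus_fun_apply)
  finally show ?thesis .
qed

text \<open>The value at the empty word is junk, as the algebra need not have a unit.\<close>

fun word_prod :: "('v \<Rightarrow> ('v, 'a) tensor) \<Rightarrow> 'v list \<Rightarrow> ('v, 'a) tensor" where
  "word_prod G [] = 0"
| "word_prod G (b # w) = foldl (\<lambda>P c. P \<bullet> G c) (G b) w"

lemma word_prod_snoc: "w \<noteq> [] \<Longrightarrow> word_prod G (w @ [b]) = word_prod G w \<bullet> G b"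
  by (cases w) auto

context
  fixes G :: "'v \<Rightarrow> ('v, 'a) tensor"
  assumes G: "b \<in> B \<Longrightarrow> G b \<in> ext_values 1"
begin

lemma word_prod_mem: "w \<in> words B k \<Longrightarrow> w \<noteq> [] \<Longrightarrow> word_prod G w \<in> ext_values k"
proof (induction w arbitrary: k rule: rev_induct)
  case (snoc b w)
  then obtain l where k: "k = l + 1" and w: "w \<in> words B l" and b: "b \<in> B"
    by (cases k) (auto simp: words_def)
  show ?case
  proof (cases "w = []")
    case True
    then show ?thesis
      using k w G[OF b] by (simp add: words_def)
  next
    case False
    then show ?thesis
      unfolding word_prod_snoc[OF False] k using snoc.IH[OF w] G[OF b] by (intro vprod_mem) auto
  qed
qed simp

text \<open>The product along a word is nested to the left, so the last letter of \<open>v\<close>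
  is peeled off and associativity regroups; membership in \<open>ext_values\<close> makes
  associativity available.\<close>

lemma word_prod_append:
  assumes u: "u \<in> words B m" "u \<noteq> []"
  shows "v \<in> words B n \<Longrightarrow> v \<noteq> [] \<Longrightarrow> word_prod G (u @ v) = word_prod G u \<bullet> word_prod G v"
proof (induction v arbitrary: n rule: rev_induct)
  case (snoc b v)
  then obtain l where v: "v \<in> words B l" and b: "b \<in> B"
    by (cases n) (auto simp: words_def)
  show ?case
  proof (cases "v = []")
    case True
    then show ?thesis
      using word_prod_snoc[OF u(2), of G b] by simp
  next
    case False
    have "word_prod G (u @ v @ [b]) = (word_prod G u \<bullet> word_prod G v) \<bullet> G b"
      using snoc.IH[OF v False] word_prod_snoc[of "u @ v" G b] u(2) by simp
    also have "\<dots> = word_prod G u \<bullet> (word_prod G v \<bullet> G b)"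
      using word_prod_mem[OF u] word_prod_mem[OF v False] G[OF b] by (rule vprod_assoc)
    finally show ?thesis
      using word_prod_snoc[OF False] by simp
  qed
qed simp

text \<open>Each further convolution with \<open>H\<close> splits off the last letter of a
  word.\<close>

lemma conv_pow_Suc_eq:
  assumes H: "\<And>x. x \<in> qext B \<sigma> q 1 \<Longrightarrow> H x = extend (word_prod G) 1 x"
    and x: "x \<in> qext B \<sigma> q (Suc k)"
  shows "conv_pow_Suc sc B \<sigma> q k H x = extend (word_prod G) (Suc k) x"
  using x
proof (induction k arbitrary: x)
  case 0
  then show ?case
    using H by simp
next
  case (Suc k)
  have "conv sc B \<sigma> q (Suc k) 1 (conv_pow_Suc sc B \<sigma> q k H) H x = extend (word_prod G) (Suc k + 1) x"
  proof (rule conv_eq_extend[OF _ Suc.IH H])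
    show "x \<in> qext B \<sigma> q (Suc k + 1)"
      using Suc.prems by simp
    fix u v assume "u \<in> words B (Suc k)" "v \<in> words B 1"
    then show "word_prod G (u @ v) = word_prod G u \<bullet> word_prod G v"
      by (intro word_prod_append) (auto simp: words_def)
  qed
  then show ?case
    by simp
qed

lemma conv_pow_eq:
  assumes "\<And>x. x \<in> qext B \<sigma> q 1 \<Longrightarrow> H x = extend (word_prod G) 1 x"
    and "x \<in> qext B \<sigma> q k" and "k \<ge> 1"
  shows "conv_pow sc B \<sigma> q k H x = extend (word_prod G) k x"
  using conv_pow_Suc_eq[OF assms(1), of x "k - 1"] assms(2,3) by (simp add: conv_pow_def)

lemma extend_word_prod_mem: "k \<ge> 1 \<Longrightarrow> extend (word_prod G) k x \<in> ext_values k"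
  unfolding extend_def
  by (intro ext_values_sum ext_values_vscale word_prod_mem) (auto simp: words_def)

lemma extend_word_prod_tprod:
  assumes "y \<in> tensors B m" "z \<in> tensors B n" "m \<ge> 1" "n \<ge> 1"
  shows "extend (word_prod G) (m + n) (y \<otimes>\<^sub>T z) = extend (word_prod G) m y \<bullet> extend (word_prod G) n z"
proof (rule vprod_extend[OF assms(1,2), symmetric])
  fix u v assume "u \<in> words B m" "v \<in> words B n"
  then show "word_prod G (u @ v) = word_prod G u \<bullet> word_prod G v"
    using assms(3,4) by (intro word_prod_append) (auto simp: words_def)
qed

end

section \<open>Coordinates with respect to a basis\<close>

lemma vscale_vtensor: "vscale sc c (vtensor sc x a) = vtensor sc x (sc c a)"
  by (simp add: vscale_def vtensor_def mult.commute)

lemma vtensor_sum_left: "vtensor sc (\<Sum>i\<in>A. x i) a = (\<Sum>i\<in>A. vtensor sc (x i) a)"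
  by (simp add: vtensor_def fun_eq_iff sum_fun_apply scale_sum_left)

lemma vtensor_scale_left: "vtensor sc (c \<cdot>\<^sub>T x) a = vtensor sc x (sc c a)"
  by (simp add: vtensor_def fun_eq_iff tscale_def mult.commute)

lemma vtensor_add_right: "vtensor sc x (a + b) = vtensor sc x a + vtensor sc x b"
  by (simp add: vtensor_def fun_eq_iff scale_right_distrib)

lemma vtensor_sum_right: "vtensor sc x (\<Sum>i\<in>A. a i) = (\<Sum>i\<in>A. vtensor sc x (a i))"
  by (simp add: vtensor_def fun_eq_iff sum_fun_apply scale_sum_right)

lemma qext_basis_expansion:
  assumes basis: "qext_basis B \<sigma> q k e" and x: "x \<in> qext B \<sigma> q k"
  shows "\<exists>c. x = (\<Sum>l=1..qext_dim B \<sigma> q k. c l \<cdot>\<^sub>T e l)"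
proof -
  let ?D = "{1..qext_dim B \<sigma> q k}"
  have "x \<in> tensor.span (e ` ?D)"
    using basis x by (simp add: qext_basis_def)
  then obtain f where "x = (\<Sum>v\<in>e ` ?D. f v \<cdot>\<^sub>T v)"
    by (auto simp: tensor.span_finite)
  also have "\<dots> = (\<Sum>l\<in>?D. f (e l) \<cdot>\<^sub>T e l)"
    using basis by (subst sum.reindex) (auto simp: qext_basis_def)
  finally show ?thesis
    by (intro exI[of _ "\<lambda>l. f (e l)"])
qed

lemma ext_values_expansion:
  assumes basis: "qext_basis B \<sigma> q k e" and P: "P \<in> ext_values k"
  shows "\<exists>c. P = (\<Sum>l=1..qext_dim B \<sigma> q k. vtensor sc (e l) (c l))"
  using P
proof (induction rule: ext_values.induct)
  case zero
  show ?case
    by (rule exI[of _ "\<lambda>_. 0"]) (simp add: vtensor_def fun_eq_iff sum_fun_apply)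
next
  case (step x P a)
  obtain c where P: "P = (\<Sum>l=1..qext_dim B \<sigma> q k. vtensor sc (e l) (c l))"
    using step.IH by blast
  obtain b where x: "x = (\<Sum>l=1..qext_dim B \<sigma> q k. b l \<cdot>\<^sub>T e l)"
    using qext_basis_expansion[OF basis step.hyps(1)] by blast
  have "vtensor sc x a + P = (\<Sum>l=1..qext_dim B \<sigma> q k. vtensor sc (e l) (sc (b l) a + c l))"
    unfolding P x vtensor_sum_left vtensor_scale_left vtensor_add_right sum.distrib ..
  then show ?case
    by (intro exI[of _ "\<lambda>l. sc (b l) a + c l"])
qed

text \<open>Independence is over the complex numbers while the coefficients lie in the algebra. A
  functional \<phi> dual to \<open>e j\<close> is therefore applied to the tensor part alone, which
  leaves \<open>c j\<close>.\<close>

lemma vtensor_basis_zero: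
  assumes basis: "qext_basis B \<sigma> q k e"
    and vanish: "(\<Sum>l=1..qext_dim B \<sigma> q k. vtensor sc (e l) (c l)) = 0"
    and j: "j \<in> {1..qext_dim B \<sigma> q k}"
  shows "c j = 0"
proof -
  let ?D = "{1..qext_dim B \<sigma> q k}"
  interpret functional: vector_space_pair tscale "(*) :: complex \<Rightarrow> complex \<Rightarrow> complex"
    by unfold_locales (auto simp: algebra_simps)
  have indep: "tensor.independent (e ` ?D)" and inj: "inj_on e ?D"
    and mem: "\<And>l. l \<in> ?D \<Longrightarrow> e l \<in> tensors B k"
  proof -
    show "tensor.independent (e ` ?D)" "inj_on e ?D"
      using basis by (auto simp: qext_basis_def)
    show "e l \<in> tensors B k" if "l \<in> ?D" for l
    proof -
      have "e l \<in> tensor.span (e ` ?D)"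
        using that by (intro tensor.span_base) auto
      then show ?thesis
        using basis qext_subset by (auto simp: qext_basis_def)
    qed
  qed
  obtain \<phi> where lin: "Vector_Spaces.linear tscale (*) \<phi>"
    and \<phi>: "\<forall>x\<in>e ` ?D. \<phi> x = (if x = e j then 1 else 0)"
    using functional.linear_independent_extend[OF indep, of "\<lambda>x. if x = e j then 1 else 0"] by blast
  interpret Vector_Spaces.linear tscale "(*)" \<phi>
    by (rule lin)
  \<comment> \<open>On an algebra-valued tensor \<phi> acts through the word basis: the value at
    \<open>w\<close> is weighted by \<open>\<phi> (unit_tensor w)\<close>.\<close>
  have "0 = (\<Sum>w\<in>words B k. sc (\<phi> (unit_tensor w)) ((\<Sum>l\<in>?D. vtensor sc (e l) (c l)) w))"
    unfolding vanish by simp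
  also have "\<dots> = (\<Sum>l\<in>?D. sc (\<Sum>w\<in>words B k. e l w * \<phi> (unit_tensor w)) (c l))"
    by (simp add: sum_fun_apply vtensor_def scale_sum_right scale_sum_left mult.commute)
      (rule sum.swap)
  also have "\<dots> = (\<Sum>l\<in>?D. sc (if l = j then 1 else 0) (c l))"
  proof (intro sum.cong refl arg_cong2[of _ _ _ _ sc])
    fix l assume l: "l \<in> ?D"
    have "(\<Sum>w\<in>words B k. e l w * \<phi> (unit_tensor w)) = \<phi> (\<Sum>w\<in>words B k. e l w \<cdot>\<^sub>T unit_tensor w)"
      by (simp add: sum scale)
    also have "\<dots> = \<phi> (e l)"
      using tensor_expansion[OF fin mem[OF l]] by simp
    also have "\<dots> = (if l = j then 1 else 0)"
      using \<phi> l j inj by (auto dest: inj_onD)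
    finally show "(\<Sum>w\<in>words B k. e l w * \<phi> (unit_tensor w)) = (if l = j then 1 else 0)" .
  qed
  also have "\<dots> = (\<Sum>l\<in>?D. if l = j then c l else 0)"
    by (intro sum.cong) auto
  also have "\<dots> = c j"
    using j by simp
  finally show ?thesis ..
qed

text \<open>The \<open>THE\<close> in \<open>qminor\<close> needs uniqueness: the difference of two
  coordinate families vanishes by \<open>vtensor_basis_zero\<close>.\<close>

lemma qminor_eqI:
  assumes basis: "qext_basis B \<sigma> q k (\<omega> k)"
    and eq: "conv_pow sc B \<sigma> q k H (\<omega> k i) = (\<Sum>l=1..qext_dim B \<sigma> q k. vtensor sc (\<omega> k l) (c l))"
    and j: "j \<in> {1..qext_dim B \<sigma> q k}"
  shows "qminor sc B \<sigma> q \<omega> H k i j = c j"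
  unfolding qminor_def
proof (rule the_equality)
  show "\<exists>c'. conv_pow sc B \<sigma> q k H (\<omega> k i) = (\<Sum>l=1..qext_dim B \<sigma> q k. vtensor sc (\<omega> k l) (c' l)) \<and> c' j = c j"
    using eq by blast
  fix a assume "\<exists>c'. conv_pow sc B \<sigma> q k H (\<omega> k i) =
    (\<Sum>l=1..qext_dim B \<sigma> q k. vtensor sc (\<omega> k l) (c' l)) \<and> c' j = a"
  then obtain c' where c': "conv_pow sc B \<sigma> q k H (\<omega> k i) =
    (\<Sum>l=1..qext_dim B \<sigma> q k. vtensor sc (\<omega> k l) (c' l))" "c' j = a"
    by blast
  have "vtensor sc (\<omega> k l) (c' l - c l) = vtensor sc (\<omega> k l) (c' l) - vtensor sc (\<omega> k l) (c l)" for l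
    by (simp add: vtensor_def fun_eq_iff scale_right_diff_distrib)
  then have "(\<Sum>l=1..qext_dim B \<sigma> q k. vtensor sc (\<omega> k l) (c' l - c l)) = 0"
    using eq c'(1) by (simp add: sum_subtractf)
  from vtensor_basis_zero[OF basis this j] show "a = c j"
    using c'(2) by simp
qed

text \<open>By \<open>coprod_eq\<close>, \<open>lam\<close> expands the basis element of degree m +
  n itself in pure tensors. The product along words turns each of these into a product of values in
  degrees m and n, and \<open>mu\<close> rewrites the products of basis elements.\<close>

lemma qminor_conv:
  assumes G: "\<And>b. b \<in> B \<Longrightarrow> G b \<in> ext_values 1"
    and H: "\<And>x. x \<in> qext B \<sigma> q 1 \<Longrightarrow> H x = extend (word_prod G) 1 x"
    and basis: "\<And>k. k \<ge> 1 \<Longrightarrow> qext_basis B \<sigma> q k (\<omega> k)"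
    and m: "m \<ge> 1" and n: "n \<ge> 1"
    and mu: "\<And>r s. r \<in> {1..qext_dim B \<sigma> q m} \<Longrightarrow> s \<in> {1..qext_dim B \<sigma> q n} \<Longrightarrow>
      shuffle_prod \<sigma> q (\<omega> m r) (\<omega> n s) = (\<Sum>i=1..qext_dim B \<sigma> q (m + n). mu r s i \<cdot>\<^sub>T \<omega> (m + n) i)"
    and lam: "coprod B \<sigma> q m n (\<omega> (m + n) j) =
      (\<Sum>k=1..qext_dim B \<sigma> q m. \<Sum>l=1..qext_dim B \<sigma> q n. lam k l \<cdot>\<^sub>T (\<omega> m k \<otimes>\<^sub>T \<omega> n l))"
    and i: "i \<in> {1..qext_dim B \<sigma> q (m + n)}" and j: "j \<in> {1..qext_dim B \<sigma> q (m + n)}"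
  shows "qminor sc B \<sigma> q \<omega> H (m + n) j i =
    (\<Sum>k=1..qext_dim B \<sigma> q m. \<Sum>r=1..qext_dim B \<sigma> q m. \<Sum>l=1..qext_dim B \<sigma> q n. \<Sum>s=1..qext_dim B \<sigma> q n.
       sc (lam k l * mu r s i) (qminor sc B \<sigma> q \<omega> H m k r * qminor sc B \<sigma> q \<omega> H n l s))"
proof -
  let ?D = "\<lambda>k. {1..qext_dim B \<sigma> q k}" and ?\<xi> = "qminor sc B \<sigma> q \<omega> H" and ?W = "extend (word_prod G)"
  have mem: "\<omega> k l \<in> qext B \<sigma> q k" if "k \<ge> 1" "l \<in> ?D k" for k l
    using tensor.span_base[of "\<omega> k l" "\<omega> k ` ?D k"] basis[OF that(1)] that(2)
    by (auto simp: qext_basis_def)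
  have mem': "\<omega> k l \<in> tensors B k" if "k \<ge> 1" "l \<in> ?D k" for k l
    using mem[OF that] qext_subset by blast
  have conv_pow: "conv_pow sc B \<sigma> q k H (\<omega> k l) = ?W k (\<omega> k l)" if "k \<ge> 1" "l \<in> ?D k" for k l
    using conv_pow_eq[OF G H mem[OF that] that(1)] .
  have W: "?W k (\<omega> k l) = (\<Sum>r\<in>?D k. vtensor sc (\<omega> k r) (?\<xi> k l r))" if k: "k \<ge> 1" and l: "l \<in> ?D k" for k l
  proof -
    obtain c where c: "?W k (\<omega> k l) = (\<Sum>r\<in>?D k. vtensor sc (\<omega> k r) (c r))"
      using ext_values_expansion[OF basis[OF k] extend_word_prod_mem[where G = G, OF _ k]] G by blast
    have "?\<xi> k l r = c r" if "r \<in> ?D k" for r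
      by (rule qminor_eqI[where \<omega> = \<omega> and c = c, OF basis[OF k] _ that]) (simp only: conv_pow[OF k l] c)
    then show ?thesis
      using c by simp
  qed
  have prod: "?W m (\<omega> m k) \<bullet> ?W n (\<omega> n l) = (\<Sum>i\<in>?D (m + n). vtensor sc (\<omega> (m + n) i)
      (\<Sum>r\<in>?D m. \<Sum>s\<in>?D n. sc (mu r s i) (?\<xi> m k r * ?\<xi> n l s)))"
    if k: "k \<in> ?D m" and l: "l \<in> ?D n" for k l
  proof -
    have "?W m (\<omega> m k) \<bullet> ?W n (\<omega> n l) =
        (\<Sum>r\<in>?D m. \<Sum>s\<in>?D n. vtensor sc (\<omega> m r) (?\<xi> m k r) \<bullet> vtensor sc (\<omega> n s) (?\<xi> n l s))"
      unfolding W[OF m k] W[OF n l] vprod_sum_left by (simp add: vprod_sum_right)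
    also have "\<dots> = (\<Sum>r\<in>?D m. \<Sum>s\<in>?D n. \<Sum>i\<in>?D (m + n).
        vtensor sc (\<omega> (m + n) i) (sc (mu r s i) (?\<xi> m k r * ?\<xi> n l s)))"
    proof (intro sum.cong refl)
      fix r s assume r: "r \<in> ?D m" and s: "s \<in> ?D n"
      show "vtensor sc (\<omega> m r) (?\<xi> m k r) \<bullet> vtensor sc (\<omega> n s) (?\<xi> n l s) =
          (\<Sum>i\<in>?D (m + n). vtensor sc (\<omega> (m + n) i) (sc (mu r s i) (?\<xi> m k r * ?\<xi> n l s)))"
        unfolding vprod_vtensor[OF mem'[OF m r] mem'[OF n s]] mu[OF r s] vtensor_sum_left
          vtensor_scale_left ..
    qed
    also have "\<dots> = (\<Sum>r\<in>?D m. \<Sum>i\<in>?D (m + n). \<Sum>s\<in>?D n.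
        vtensor sc (\<omega> (m + n) i) (sc (mu r s i) (?\<xi> m k r * ?\<xi> n l s)))"
      by (intro sum.cong refl sum.swap)
    also have "\<dots> = (\<Sum>i\<in>?D (m + n). \<Sum>r\<in>?D m. \<Sum>s\<in>?D n.
        vtensor sc (\<omega> (m + n) i) (sc (mu r s i) (?\<xi> m k r * ?\<xi> n l s)))"
      by (rule sum.swap)
    finally show ?thesis
      by (simp only: vtensor_sum_right)
  qed
  \<comment> \<open>The collected coefficient of the i-th basis element: \<open>lam\<close> comes
    from splitting, \<open>mu\<close> from multiplying back.\<close>
  define c where "c i = (\<Sum>k\<in>?D m. \<Sum>l\<in>?D n. sc (lam k l)
    (\<Sum>r\<in>?D m. \<Sum>s\<in>?D n. sc (mu r s i) (?\<xi> m k r * ?\<xi> n l s)))" for i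
  have mn: "m + n \<ge> 1"
    using m by simp
  have expansion: "\<omega> (m + n) j = (\<Sum>k\<in>?D m. \<Sum>l\<in>?D n. lam k l \<cdot>\<^sub>T (\<omega> m k \<otimes>\<^sub>T \<omega> n l))"
    using lam coprod_eq[OF mem[OF mn j]] by simp
  have "conv_pow sc B \<sigma> q (m + n) H (\<omega> (m + n) j) = ?W (m + n) (\<omega> (m + n) j)"
    by (rule conv_pow[OF mn j])
  also have "\<dots> = (\<Sum>k\<in>?D m. \<Sum>l\<in>?D n. vscale sc (lam k l) (?W m (\<omega> m k) \<bullet> ?W n (\<omega> n l)))"
    by (subst expansion, unfold extend_sum extend_scale)
      (intro sum.cong refl arg_cong[of _ _ "vscale sc _"] extend_word_prod_tprod[OF G mem' mem' m n] m n)
  also have "\<dots> = (\<Sum>k\<in>?D m. \<Sum>l\<in>?D n. \<Sum>i\<in>?D (m + n). vtensor sc (\<omega> (m + n) i)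
      (sc (lam k l) (\<Sum>r\<in>?D m. \<Sum>s\<in>?D n. sc (mu r s i) (?\<xi> m k r * ?\<xi> n l s))))"
  proof (intro sum.cong refl)
    fix k l assume k: "k \<in> ?D m" and l: "l \<in> ?D n"
    show "vscale sc (lam k l) (?W m (\<omega> m k) \<bullet> ?W n (\<omega> n l)) =
        (\<Sum>i\<in>?D (m + n). vtensor sc (\<omega> (m + n) i)
      (sc (lam k l) (\<Sum>r\<in>?D m. \<Sum>s\<in>?D n. sc (mu r s i) (?\<xi> m k r * ?\<xi> n l s))))"
      unfolding prod[OF k l] vscale_sum vscale_vtensor ..
  qed
  also have "\<dots> = (\<Sum>k\<in>?D m. \<Sum>i\<in>?D (m + n). \<Sum>l\<in>?D n. vtensor sc (\<omega> (m + n) i)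
      (sc (lam k l) (\<Sum>r\<in>?D m. \<Sum>s\<in>?D n. sc (mu r s i) (?\<xi> m k r * ?\<xi> n l s))))"
    by (intro sum.cong refl sum.swap)
  also have "\<dots> = (\<Sum>i\<in>?D (m + n). \<Sum>k\<in>?D m. \<Sum>l\<in>?D n. vtensor sc (\<omega> (m + n) i)
      (sc (lam k l) (\<Sum>r\<in>?D m. \<Sum>s\<in>?D n. sc (mu r s i) (?\<xi> m k r * ?\<xi> n l s))))"
    by (rule sum.swap)
  also have "\<dots> = (\<Sum>i\<in>?D (m + n). vtensor sc (\<omega> (m + n) i) (c i))"
    by (simp only: c_def vtensor_sum_right)
  finally have "?\<xi> (m + n) j i = c i"
    by (rule qminor_eqI[where \<omega> = \<omega>, OF basis[OF mn] _ i])
  also have "\<dots> = (\<Sum>k\<in>?D m. \<Sum>l\<in>?D n. \<Sum>r\<in>?D m. \<Sum>s\<in>?D n.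
      sc (lam k l * mu r s i) (?\<xi> m k r * ?\<xi> n l s))"
    by (simp add: c_def scale_sum_right)
  also have "\<dots> = (\<Sum>k\<in>?D m. \<Sum>r\<in>?D m. \<Sum>l\<in>?D n. \<Sum>s\<in>?D n.
      sc (lam k l * mu r s i) (?\<xi> m k r * ?\<xi> n l s))"
    by (intro sum.cong refl sum.swap)
  finally show ?thesis .
qed

end

theorem theorem6p5:
  fixes scV :: "complex \<Rightarrow> 'v::ab_group_add \<Rightarrow> 'v" and B :: "'v set"
    and \<sigma> :: "('v, complex) tensor \<Rightarrow> ('v, complex) tensor"
    and q :: complex
    and sc :: "complex \<Rightarrow> 'a::ring \<Rightarrow> 'a"
    and \<omega> :: "nat \<Rightarrow> nat \<Rightarrow> ('v, complex) tensor"
    and d :: "nat \<Rightarrow> nat"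
    and m n p :: nat
    and mu lam :: "nat \<Rightarrow> nat \<Rightarrow> nat \<Rightarrow> complex"
    and F :: "'v \<Rightarrow> ('v, 'a) tensor"
    and \<xi> :: "nat \<Rightarrow> nat \<Rightarrow> nat \<Rightarrow> 'a"
  assumes q_nonzero: "q \<noteq> 0"
    and q_generic: "\<forall>r\<ge>1. (q powi (-2)) ^ r \<noteq> 1"
    and V: "finite_dimensional_vector_space scV B"
    and braiding: "braiding B \<sigma>"
    and algebra: "complex_assoc_algebra sc"
    and d_def: "\<forall>k. d k = qext_dim B \<sigma> q k"
    and basis: "\<forall>k\<ge>1. qext_basis B \<sigma> q k (\<omega> k)"
    and m: "m \<ge> 1" and n: "n \<ge> 1" and p: "p = m + n"
    and mu: "\<forall>i\<in>{1..d m}. \<forall>j\<in>{1..d n}.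
      shuffle_prod \<sigma> q (\<omega> m i) (\<omega> n j) = (\<Sum>k=1..d p. mu i j k \<cdot>\<^sub>T \<omega> p k)"
    and lam: "\<forall>k\<in>{1..d p}.
      coprod B \<sigma> q m n (\<omega> p k) = (\<Sum>i=1..d m. \<Sum>j=1..d n. lam k i j \<cdot>\<^sub>T (\<omega> m i \<otimes>\<^sub>T \<omega> n j))"
    and F_linear: "Vector_Spaces.linear scV (vscale sc) F"
    and F_range: "\<forall>v. F v \<in> tensors B 1"
    and xi_def: "\<xi> = qminor sc B \<sigma> q \<omega> (degree_one_map scV B F)"
    and i: "i \<in> {1..d p}" and j: "j \<in> {1..d p}"
  shows "\<xi> (m + n) j i =
    (\<Sum>k=1..d m. \<Sum>r=1..d m. \<Sum>l=1..d n. \<Sum>s=1..d n.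
       sc (lam j k l * mu r s i) (\<xi> m k r * \<xi> n l s))"
proof -
  interpret V: finite_dimensional_vector_space scV B
    by (rule V)
  interpret A: complex_assoc_algebra sc
    by (rule algebra)
  interpret quantum_convolution B \<sigma> q sc
    using V.finite_Basis braiding q_nonzero q_generic by unfold_locales auto
  \<comment> \<open>Values of \<open>F\<close> are expanded over one-letter words, whose unit
    tensors are generators and so lie in the first exterior power.\<close>
  have F_mem: "F b \<in> ext_values 1" for b
  proof -
    have "F b = (\<Sum>w\<in>words B 1. vtensor sc (unit_tensor w) (F b w))"
    proof
      fix v
      have "(\<Sum>w\<in>words B 1. vtensor sc (unit_tensor w) (F b w)) v =
          (\<Sum>w\<in>words B 1. if w = v then F b v else 0)"
        by (auto simp: sum_fun_apply vtensor_def unit_tensor_def intro!: sum.cong)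
      also have "\<dots> = F b v"
        using F_range[rule_format, of b] finite_words[OF V.finite_Basis, of 1] by (auto simp: tensors_def)
      finally show "F b v = (\<Sum>w\<in>words B 1. vtensor sc (unit_tensor w) (F b w)) v" ..
    qed
    moreover have "unit_tensor w \<in> qext B \<sigma> q 1" if "w \<in> words B 1" for w
      using unit_tensor_mem[OF that] by (simp add: qext_def qext_algebra.gen)
    ultimately show ?thesis
      using ext_values_sum[of "words B 1" "\<lambda>w. vtensor sc (unit_tensor w) (F b w)" 1] ext_values_vtensor
      by simp
  qed
  \<comment> \<open>One-letter words correspond to the vectors of \<open>B\<close>, and
    \<open>word_prod F [b]\<close> is \<open>F b\<close>, so this is linearity of
    \<open>F\<close>.\<close>
  have degree_one: "degree_one_map scV B F x = extend (word_prod F) 1 x" for x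
  proof -
    interpret F: Vector_Spaces.linear scV "vscale sc" F
      by (rule F_linear)
    have words: "words B 1 = (\<lambda>b. [b]) ` B"
      by (auto simp: words_def length_Suc_conv)
    show ?thesis
      unfolding degree_one_map_def extend_def words F.sum F.scale
      by (subst sum.reindex) (auto simp: inj_on_def)
  qed
  show ?thesis
    unfolding xi_def d_def[rule_format] p
    by (rule qminor_conv[OF F_mem degree_one])
      (use basis m n mu lam i j in \<open>simp_all add: d_def p\<close>)
qed

end
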